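(* Let $F$ be a non-cyclic free group and $N$ a normal subgroup of $F$. Let $\mathcal{V}$ be a proper variety of groups. Then the group $\mathcal{V}(F)/\mathcal{V}(N)$ has a non-trivial quotient belonging to $\mathcal{V}$ if and only if $F/N$ has a non-trivial quotient belonging to $\mathcal{V}$.
   Context: Given a set of words in a countable group alphabet, the corresponding variety of groups $\mathcal{V}$ is the class of all groups in which $w=1$ is an identical relation (law) for every word $w$ of the set. A variety is proper if it is not the class of all groups. For a group $G$, the verbal subgroup $\mathcal{V}(G)$ is the subgroup of $G$ generated by all values of the words of the set when their letters are replaced by elements of $G$. *)

theory Defs
  imports "HOL-Algebra.Algebra"
begin

(* A group word over an alphabet 'x is a list of signed letters: (x, True) stands for x and
   (x, False) for its formal inverse. Words need not be reduced. *)
type_synonym 'x gword = "('x \<times> bool) list"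

fun word_value :: "('a, 'm) monoid_scheme \<Rightarrow> ('x \<Rightarrow> 'a) \<Rightarrow> 'x gword \<Rightarrow> 'a" where
  "word_value G f [] = \<one>\<^bsub>G\<^esub>"
| "word_value G f ((x, b) # w) =
     (if b then f x else inv\<^bsub>G\<^esub> (f x)) \<otimes>\<^bsub>G\<^esub> word_value G f w"

definition reduced :: "'x gword \<Rightarrow> bool" where
  "reduced w \<longleftrightarrow> (\<nexists>u v x b. w = u @ [(x, b), (x, \<not> b)] @ v)"

(* S may be infinite or empty; the words here use the elements of S themselves as letters. *)
definition free_basis :: "('a, 'm) monoid_scheme \<Rightarrow> 'a set \<Rightarrow> bool" where
  "free_basis F S \<longleftrightarrow> S \<subseteq> carrier F \<and>
     (\<forall>g \<in> carrier F. \<exists>!w. reduced w \<and> fst ` set w \<subseteq> S \<and> word_value F (\<lambda>x. x) w = g)"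

definition free_group :: "('a, 'm) monoid_scheme \<Rightarrow> bool" where
  "free_group F \<longleftrightarrow> group F \<and> (\<exists>S. free_basis F S)"

(* The letters of the words defining a variety are x_0, x_1, ..., indexed by nat. *)
definition is_law :: "('a, 'm) monoid_scheme \<Rightarrow> nat gword \<Rightarrow> bool" where
  "is_law G w \<longleftrightarrow> (\<forall>f. range f \<subseteq> carrier G \<longrightarrow> word_value G f w = \<one>\<^bsub>G\<^esub>)"

(* The variety is represented by its set W of defining words; membership is polymorphic in the
   type of the carrier, so groups over different types can be tested against the same variety. *)
definition in_variety :: "nat gword set \<Rightarrow> ('a, 'm) monoid_scheme \<Rightarrow> bool" where
  "in_variety W G \<longleftrightarrow> group G \<and> (\<forall>w \<in> W. is_law G w)"

definition verbal_subgroup :: "nat gword set \<Rightarrow> ('a, 'm) monoid_scheme \<Rightarrow> 'a set" where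
  "verbal_subgroup W G =
     generate G {word_value G f w | f w. w \<in> W \<and> range f \<subseteq> carrier G}"

definition has_nontrivial_quotient_in :: "nat gword set \<Rightarrow> ('a, 'm) monoid_scheme \<Rightarrow> bool" where
  "has_nontrivial_quotient_in W G \<longleftrightarrow>
     (\<exists>M. M \<lhd> G \<and> \<not> trivial_group (G Mod M) \<and> in_variety W (G Mod M))"

end

theory Submission
  imports Defs "HOL-Library.Countable"
begin

text \<open>A group has a non-trivial quotient in \<open>\<V>\<close> iff it differs from its verbal subgroup. Hence, with
  \<open>A = \<V>(F)\<close>, the claim is that \<open>\<V>(N) \<V>(A) = A\<close> iff \<open>N A = F\<close>. If \<open>N A = F\<close>, then
  \<open>\<V>(N A) \<subseteq> N \<V>(A)\<close> gives \<open>F = N \<V>(A)\<close>, and then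
  \<open>A = \<V>(\<V>(A) N) \<subseteq> \<V>(A) \<V>(N)\<close>.

  Conversely, if \<open>\<V>(N) \<V>(A) = A\<close> but \<open>M = N A\<close> is proper, then \<open>\<V>(M) = \<V>(F) = A\<close>, so
  that every homomorphism \<open>M \<rightarrow> F\<close> maps \<open>A\<close> into itself. Such homomorphisms are abundant: they are
  obtained by labelling the edges of the Cayley graph of \<open>F / M\<close> with elements of \<open>F\<close>. Given a
  non-empty reduced word all of whose values lie in \<open>A\<close>, substitute an element outside \<open>M\<close> for its
  first letter and elements of \<open>M\<close> for the others. Following the labels along the resulting path
  yields a shorter non-empty reduced word with the same property. This descent shows that there is no
  such word, contradicting that \<open>\<V>\<close> is proper.\<close>

subsection \<open>Words and free reduction\<close>

text \<open>The descent is Reidemeister-Schreier rewriting. Words whose exponent sum in the first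
  letter \<open>x\<close> is divisible by \<open>n\<close> form a subgroup of the free group on the
  letters, with basis \<open>x^n\<close> (the new letter \<open>None\<close>) and
  \<open>x^i y x^(-i)\<close> for \<open>i\<close> modulo \<open>n\<close> (the new letter
  \<open>Some (y, i)\<close>); for \<open>n = 0\<close> only the latter occur, with all integers
  \<open>i\<close>. Here \<open>n\<close> is the order, modulo a normal subgroup, of the element
  substituted for \<open>x\<close>, and 0 stands for infinite order. The obstacle is to give all new
  letters arbitrary values at once, although nothing is known about \<open>F / M\<close>. An element
  of infinite order modulo \<open>M\<close> supplies infinitely many translates of one labelled
  edge. If all basis elements have finite order modulo \<open>M\<close>, the powers of one of them
  give only finitely many coordinates, and two homomorphisms have to be composed. If
  \<open>M\<close> is trivial, it contains no relator to work with, and another normal subgroup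
  takes its place.\<close>

fun push :: "'x \<times> bool \<Rightarrow> 'x gword \<Rightarrow> 'x gword" where
  "push l [] = [l]"
| "push l (k # w) = (if fst k = fst l \<and> snd k \<noteq> snd l then w else l # k # w)"

definition free_reduce :: "'x gword \<Rightarrow> 'x gword" where
  "free_reduce w = foldr push w []"

lemma reduced_Nil [simp]: "reduced []"
  by (simp add: reduced_def)

text \<open>Replaces the condition on factors by a test on the first two letters, the form that list
  induction needs.\<close>

lemma reduced_Cons:
  "reduced (l # w) \<longleftrightarrow> reduced w \<and> (w = [] \<or> hd w \<noteq> (fst l, \<not> snd l))"
proof
  assume r: "reduced (l # w)"
  have "reduced w"
    unfolding reduced_def
  proof
    assume "\<exists>u v x b. w = u @ [(x, b), (x, \<not> b)] @ v"
    then obtain u v x b where "w = u @ [(x, b), (x, \<not> b)] @ v" by blast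
    then have "l # w = (l # u) @ [(x, b), (x, \<not> b)] @ v" by simp
    with r show False unfolding reduced_def by blast
  qed
  moreover have "w = [] \<or> hd w \<noteq> (fst l, \<not> snd l)"
  proof (rule ccontr)
    assume "\<not> ?thesis"
    then have "l # w = [] @ [(fst l, snd l), (fst l, \<not> snd l)] @ tl w"
      by (cases w) auto
    with r show False unfolding reduced_def by blast
  qed
  ultimately show "reduced w \<and> (w = [] \<or> hd w \<noteq> (fst l, \<not> snd l))" by blast
next
  assume r: "reduced w \<and> (w = [] \<or> hd w \<noteq> (fst l, \<not> snd l))"
  show "reduced (l # w)"
    unfolding reduced_def
  proof
    assume "\<exists>u v x b. l # w = u @ [(x, b), (x, \<not> b)] @ v"
    then obtain u v x b where e: "l # w = u @ [(x, b), (x, \<not> b)] @ v" by blast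
    show False
    proof (cases u)
      case Nil
      then show False using e r by auto
    next
      case (Cons k u')
      then have "w = u' @ [(x, b), (x, \<not> b)] @ v" using e by simp
      then show False using r unfolding reduced_def by blast
    qed
  qed
qed

lemma reduced_appendD: "reduced (u @ v) \<Longrightarrow> reduced u \<and> reduced v"
proof (induction u)
  case (Cons l u)
  then show ?case by (cases u) (auto simp: reduced_Cons)
qed simp

lemma reduced_push: "reduced w \<Longrightarrow> reduced (push l w)"
  by (cases w) (auto simp: reduced_Cons prod_eq_iff)

lemma reduced_free_reduce: "reduced (free_reduce w)"
  unfolding free_reduce_def by (induction w) (auto simp: reduced_push)

lemma set_push: "set (push l w) \<subseteq> insert l (set w)"
  by (cases w) auto

lemma set_free_reduce: "set (free_reduce w) \<subseteq> set w"
  unfolding free_reduce_def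
proof (induction w)
  case (Cons l w)
  then show ?case using set_push[of l "foldr push w []"] by auto
qed simp

lemma reduced_map:
  assumes "inj g"
  shows "reduced (map (apfst g) w) \<longleftrightarrow> reduced w"
proof (induction w)
  case (Cons l w)
  then show ?case using assms
    by (cases w) (auto simp: reduced_Cons prod_eq_iff inj_eq)
qed simp

section \<open>Evaluation of words in a group\<close>

context group
begin

lemma word_value_closed:
  "f ` fst ` set w \<subseteq> carrier G \<Longrightarrow> word_value G f w \<in> carrier G"
  by (induction w) auto

lemma word_value_append:
  "f ` fst ` set u \<subseteq> carrier G \<Longrightarrow> f ` fst ` set v \<subseteq> carrier G \<Longrightarrow>
    word_value G f (u @ v) = word_value G f u \<otimes> word_value G f v"
proof (induction u)
  case Nil
  then show ?case by (simp add: word_value_closed)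
next
  case (Cons l u)
  then show ?case by (cases l) (simp add: m_assoc word_value_closed)
qed

lemma word_value_push:
  assumes "f ` fst ` set (l # w) \<subseteq> carrier G"
  shows "word_value G f (push l w) = word_value G f (l # w)"
proof (cases w)
  case (Cons k v)
  then have "word_value G f v \<in> carrier G" using assms by (simp add: word_value_closed)
  with Cons show ?thesis using assms
    by (cases k; cases l; cases "snd k"; cases "snd l") (auto simp: m_assoc[symmetric])
qed (cases l, simp)

lemma word_value_free_reduce:
  "f ` fst ` set w \<subseteq> carrier G \<Longrightarrow> word_value G f (free_reduce w) = word_value G f w"
proof (induction w)
  case (Cons l w)
  have "f ` fst ` set (l # free_reduce w) \<subseteq> carrier G"
    using Cons.prems set_free_reduce[of w] by auto
  then have "word_value G f (free_reduce (l # w)) = word_value G f (l # free_reduce w)"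
    using word_value_push[of f l "free_reduce w"] by (simp add: free_reduce_def)
  with Cons show ?case by (cases l) simp
qed (simp add: free_reduce_def)

lemma word_value_in_subgroup:
  "subgroup H G \<Longrightarrow> f ` fst ` set w \<subseteq> H \<Longrightarrow> word_value G f w \<in> H"
  by (induction w) (auto simp: subgroup.one_closed subgroup.m_closed subgroup.m_inv_closed)

lemma word_value_subgroup:
  "subgroup H G \<Longrightarrow> f ` fst ` set w \<subseteq> H \<Longrightarrow> word_value (G\<lparr>carrier := H\<rparr>) f w = word_value G f w"
  by (induction w) (auto simp: m_inv_consistent)

end

lemma word_value_map:
  "word_value G f (map (apfst g) w) = word_value G (f \<circ> g) w"
  by (induction w) auto

lemma (in group_hom) hom_word_value:
  "f ` fst ` set w \<subseteq> carrier G \<Longrightarrow> h (word_value G f w) = word_value H (h \<circ> f) w"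
proof (induction w)
  case (Cons l w)
  then have "word_value G f w \<in> carrier G" by (simp add: G.word_value_closed)
  with Cons show ?case by (cases l) simp
qed simp

subsection \<open>Cocycles on free groups\<close>

text \<open>The product of the edge labels along a path in the Cayley graph that starts at
  \<open>x\<close> and spells the word. The edge from \<open>x\<close> to
  \<open>x \<otimes> s\<close> carries \<open>f x s\<close>; an inverse letter runs backwards along
  the edge that begins at \<open>x \<otimes> inv s\<close>.\<close>

fun word_cocycle :: "('a, 'm) monoid_scheme \<Rightarrow> ('a \<Rightarrow> 'a \<Rightarrow> 'a) \<Rightarrow> 'a \<Rightarrow> 'a gword \<Rightarrow> 'a" where
  "word_cocycle F f x [] = \<one>\<^bsub>F\<^esub>"
| "word_cocycle F f x ((s, b) # w) =
    (if b then f x s \<otimes>\<^bsub>F\<^esub> word_cocycle F f (x \<otimes>\<^bsub>F\<^esub> s) w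
     else inv\<^bsub>F\<^esub> (f (x \<otimes>\<^bsub>F\<^esub> inv\<^bsub>F\<^esub> s) s) \<otimes>\<^bsub>F\<^esub> word_cocycle F f (x \<otimes>\<^bsub>F\<^esub> inv\<^bsub>F\<^esub> s) w)"

locale free_on = group F for F (structure) +
  fixes S
  assumes basis: "free_basis F S"
begin

lemma S_carrier: "S \<subseteq> carrier F"
  using basis by (simp add: free_basis_def)

lemma S_closed [simp]: "s \<in> S \<Longrightarrow> s \<in> carrier F"
  using S_carrier by blast

definition norm_word :: "'a \<Rightarrow> 'a gword" where
  "norm_word g = (THE w. reduced w \<and> fst ` set w \<subseteq> S \<and> word_value F (\<lambda>x. x) w = g)"

lemma norm_word:
  assumes "g \<in> carrier F"
  shows "reduced (norm_word g)" "fst ` set (norm_word g) \<subseteq> S" "word_value F (\<lambda>x. x) (norm_word g) = g"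
proof -
  have "\<exists>!w. reduced w \<and> fst ` set w \<subseteq> S \<and> word_value F (\<lambda>x. x) w = g"
    using basis assms by (simp add: free_basis_def)
  from theI'[OF this]
  show "reduced (norm_word g)" "fst ` set (norm_word g) \<subseteq> S" "word_value F (\<lambda>x. x) (norm_word g) = g"
    unfolding norm_word_def by blast+
qed

lemma norm_word_eqI:
  assumes "reduced w" "fst ` set w \<subseteq> S" "word_value F (\<lambda>x. x) w = g"
  shows "norm_word g = w"
proof -
  have g: "g \<in> carrier F" using assms S_carrier word_value_closed[of "\<lambda>x. x" w] by auto
  then have "\<exists>!w. reduced w \<and> fst ` set w \<subseteq> S \<and> word_value F (\<lambda>x. x) w = g"
    using basis by (simp add: free_basis_def)
  then show ?thesis using norm_word[OF g] assms by blast
qed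

lemma norm_word_value:
  assumes "fst ` set w \<subseteq> S"
  shows "norm_word (word_value F (\<lambda>x. x) w) = free_reduce w"
proof (rule norm_word_eqI)
  show "fst ` set (free_reduce w) \<subseteq> S" using assms set_free_reduce[of w] by auto
  show "word_value F (\<lambda>x. x) (free_reduce w) = word_value F (\<lambda>x. x) w"
    using assms S_carrier by (intro word_value_free_reduce) auto
qed (rule reduced_free_reduce)

lemma word_value_S_closed [simp]: "fst ` set w \<subseteq> S \<Longrightarrow> word_value F (\<lambda>x. x) w \<in> carrier F"
  using S_carrier word_value_closed[of "\<lambda>x. x" w] by auto

lemma generate_S: "generate F S = carrier F"
proof
  show "generate F S \<subseteq> carrier F" using S_carrier generate_incl by blast
  show "carrier F \<subseteq> generate F S"
  proof
    fix g assume g: "g \<in> carrier F"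
    have "word_value F (\<lambda>x. x) (norm_word g) \<in> generate F S"
      using norm_word(2)[OF g] S_carrier
      by (intro word_value_in_subgroup generate_is_subgroup) (auto intro: generate.incl)
    with norm_word(3)[OF g] show "g \<in> generate F S" by simp
  qed
qed

context
  fixes f :: "'a \<Rightarrow> 'a \<Rightarrow> 'a"
  assumes f: "\<And>x s. x \<in> carrier F \<Longrightarrow> s \<in> S \<Longrightarrow> f x s \<in> carrier F"
begin

lemma word_cocycle_closed:
  "x \<in> carrier F \<Longrightarrow> fst ` set w \<subseteq> S \<Longrightarrow> word_cocycle F f x w \<in> carrier F"
  by (induction w arbitrary: x) (auto simp: f)

lemma word_cocycle_append:
  "x \<in> carrier F \<Longrightarrow> fst ` set u \<subseteq> S \<Longrightarrow> fst ` set v \<subseteq> S \<Longrightarrow>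
    word_cocycle F f x (u @ v) = word_cocycle F f x u \<otimes> word_cocycle F f (x \<otimes> word_value F (\<lambda>x. x) u) v"
proof (induction u arbitrary: x)
  case Nil
  then show ?case by (simp add: word_cocycle_closed)
next
  case (Cons l u)
  then show ?case by (cases l) (auto simp: m_assoc f word_cocycle_closed)
qed

text \<open>A cancelling pair runs along one edge forth and back, so its two labels cancel.\<close>

lemma word_cocycle_push:
  assumes x: "x \<in> carrier F" and "fst ` set (l # w) \<subseteq> S"
  shows "word_cocycle F f x (push l w) = word_cocycle F f x (l # w)"
proof (cases w)
  case (Cons k v)
  obtain s b where l: "l = (s, b)" by fastforce
  obtain t c where k: "k = (t, c)" by fastforce
  have s: "s \<in> S" and v: "fst ` set v \<subseteq> S" using assms l Cons by auto
  show ?thesis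
  proof (cases "t = s \<and> c \<noteq> b")
    case True
    have "word_cocycle F f x v \<in> carrier F" using x v by (simp add: word_cocycle_closed)
    then show ?thesis using True s x Cons l k f
      by (cases b) (auto simp: m_assoc, simp_all add: m_assoc[symmetric] f)
  qed (use Cons l k in auto)
qed (cases l, simp)

lemma word_cocycle_free_reduce:
  "x \<in> carrier F \<Longrightarrow> fst ` set w \<subseteq> S \<Longrightarrow> word_cocycle F f x (free_reduce w) = word_cocycle F f x w"
proof (induction w arbitrary: x)
  case (Cons l w)
  have "fst ` set (l # free_reduce w) \<subseteq> S"
    using Cons.prems set_free_reduce[of w] by auto
  then have "word_cocycle F f x (free_reduce (l # w)) = word_cocycle F f x (l # free_reduce w)"
    using word_cocycle_push[of x l "free_reduce w"] Cons.prems by (simp add: free_reduce_def)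
  with Cons show ?case by (cases l) simp
qed (simp add: free_reduce_def)

end

definition cocycle :: "('a \<Rightarrow> 'a \<Rightarrow> 'a) \<Rightarrow> 'a \<Rightarrow> 'a \<Rightarrow> 'a" where
  "cocycle f x g = word_cocycle F f x (norm_word g)"

context
  fixes f :: "'a \<Rightarrow> 'a \<Rightarrow> 'a"
  assumes f: "\<And>x s. x \<in> carrier F \<Longrightarrow> s \<in> S \<Longrightarrow> f x s \<in> carrier F"
begin

lemma cocycle_closed: "x \<in> carrier F \<Longrightarrow> g \<in> carrier F \<Longrightarrow> cocycle f x g \<in> carrier F"
  unfolding cocycle_def by (intro word_cocycle_closed norm_word f)

text \<open>The normal form of \<open>g \<otimes> h\<close> is the free reduction of the
  concatenated normal forms, and free reduction does not change the product of labels along a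
  path.\<close>

lemma cocycle_mult:
  assumes x: "x \<in> carrier F" and g: "g \<in> carrier F" and h: "h \<in> carrier F"
  shows "cocycle f x (g \<otimes> h) = cocycle f x g \<otimes> cocycle f (x \<otimes> g) h"
proof -
  let ?w = "norm_word g @ norm_word h"
  have w: "fst ` set ?w \<subseteq> S" using norm_word(2) g h by auto
  have "word_value F (\<lambda>x. x) ?w = g \<otimes> h"
    using norm_word[OF g] norm_word[OF h] S_carrier by (subst word_value_append) auto
  then have "norm_word (g \<otimes> h) = free_reduce ?w" using norm_word_value[OF w] by simp
  then have "cocycle f x (g \<otimes> h) = word_cocycle F f x ?w"
    unfolding cocycle_def using word_cocycle_free_reduce[OF f x w] by simp
  also have "\<dots> = cocycle f x g \<otimes> cocycle f (x \<otimes> g) h"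
    unfolding cocycle_def using word_cocycle_append[OF f x] norm_word[OF g] norm_word[OF h] by simp
  finally show ?thesis .
qed

lemma cocycle_one: "x \<in> carrier F \<Longrightarrow> cocycle f x \<one> = \<one>"
  unfolding cocycle_def using norm_word_eqI[of "[]" \<one>] by simp

lemma cocycle_basis:
  assumes "x \<in> carrier F" "s \<in> S"
  shows "cocycle f x s = f x s"
proof -
  have "norm_word s = [(s, True)]"
    using assms by (intro norm_word_eqI) (auto simp: reduced_Cons)
  then show ?thesis unfolding cocycle_def using assms f by simp
qed

lemma cocycle_inv:
  assumes "x \<in> carrier F" "g \<in> carrier F"
  shows "cocycle f x (inv g) = inv (cocycle f (x \<otimes> inv g) g)"
proof -
  have "cocycle f x (inv g) \<otimes> cocycle f (x \<otimes> inv g) g = \<one>"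
    using cocycle_mult[of x "inv g" g] assms cocycle_one by simp
  then show ?thesis using assms cocycle_closed by (metis inv_closed inv_equality inv_inv m_closed)
qed

text \<open>Left translation is a symmetry of the Cayley graph, so a path translated by
  \<open>y\<close> meets the same labels.\<close>

lemma cocycle_shift:
  assumes y: "y \<in> carrier F" and inv: "\<And>x s. x \<in> carrier F \<Longrightarrow> s \<in> S \<Longrightarrow> f (y \<otimes> x) s = f x s"
    and x: "x \<in> carrier F" and g: "g \<in> carrier F"
  shows "cocycle f (y \<otimes> x) g = cocycle f x g"
proof -
  have "word_cocycle F f (y \<otimes> x) w = word_cocycle F f x w" if "fst ` set w \<subseteq> S" for w
    using that x
  proof (induction w arbitrary: x)
    case (Cons l w)
    then show ?case using y inv by (cases l) (auto simp: m_assoc)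
  qed simp
  then show ?thesis unfolding cocycle_def using norm_word(2)[OF g] by simp
qed

end

text \<open>The universal property of the free group: if the labels ignore the starting vertex, so
  does the cocycle, and its product rule becomes multiplicativity.\<close>

lemma endomorphism_exists:
  assumes "\<And>s. s \<in> S \<Longrightarrow> \<phi> s \<in> carrier F"
  obtains h where "h \<in> hom F F" "\<And>s. s \<in> S \<Longrightarrow> h s = \<phi> s"
proof
  let ?h = "cocycle (\<lambda>_. \<phi>) \<one>"
  have sh: "cocycle (\<lambda>_. \<phi>) x g = ?h g" if "x \<in> carrier F" "g \<in> carrier F" for x g
    using cocycle_shift[of "\<lambda>_. \<phi>" x \<one> g] that assms by simp
  show "?h \<in> hom F F"
  proof (rule homI)
    fix g k assume "g \<in> carrier F" "k \<in> carrier F"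
    then show "?h (g \<otimes> k) = ?h g \<otimes> ?h k"
      using cocycle_mult[of "\<lambda>_. \<phi>" \<one> g k] assms sh[of g k] by simp
  qed (use cocycle_closed[of "\<lambda>_. \<phi>"] assms in simp)
  show "?h s = \<phi> s" if "s \<in> S" for s
    using cocycle_basis[of "\<lambda>_. \<phi>"] assms that by simp
qed

end

subsection \<open>Collapsing a letter of a word\<close>

text \<open>The letter \<open>x\<close> is read as a step along a cycle of length \<open>n\<close> (a line if \<open>n = 0\<close>), starting
  at position \<open>j\<close>. It is deleted except on the edge from \<open>n - 1\<close> to \<open>0\<close>, where it leaves the letter
  \<open>None\<close>; every other letter is tagged with the position at which it is read.\<close>

fun collapse :: "'x \<Rightarrow> int \<Rightarrow> int \<Rightarrow> 'x gword \<Rightarrow> ('x \<times> int) option gword" where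
  "collapse x n j [] = []"
| "collapse x n j ((y, b) # w) =
    (if y \<noteq> x then (Some (y, j mod n), b) # collapse x n j w
     else if b then (if n \<noteq> 0 \<and> n dvd j + 1 then [(None, True)] else []) @ collapse x n (j + 1) w
     else (if n \<noteq> 0 \<and> n dvd j then [(None, False)] else []) @ collapse x n (j - 1) w)"

fun exponent_sum :: "'x \<Rightarrow> 'x gword \<Rightarrow> int" where
  "exponent_sum x [] = 0"
| "exponent_sum x ((y, b) # w) = (if y = x then if b then 1 else - 1 else 0) + exponent_sum x w"

lemma length_collapse: "length (collapse x n j w) \<le> length w"
proof (induction w arbitrary: j)
  case (Cons l w)
  then show ?case by (cases l) (auto intro: le_SucI)
qed simp

lemma mod_add_one:
  fixes n j :: int
  assumes "n \<ge> 0" "n = 0 \<or> \<not> n dvd j + 1"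
  shows "(j + 1) mod n = j mod n + 1"
proof (cases "n = 0")
  case False
  then have n: "n > 0" using assms by simp
  have "j mod n + 1 \<noteq> n"
  proof
    assume "j mod n + 1 = n"
    then have "(j + 1) mod n = 0" by (metis mod_add_left_eq mod_self)
    then show False using assms False by (simp add: dvd_eq_mod_eq_0)
  qed
  moreover have "j mod n < n" "0 \<le> j mod n" using n by simp_all
  ultimately have "(j mod n + 1) mod n = j mod n + 1" by simp
  then show ?thesis by (simp add: mod_add_left_eq)
qed simp

lemma mod_diff_one:
  fixes n j :: int
  assumes "n \<ge> 0" "n = 0 \<or> \<not> n dvd j"
  shows "(j - 1) mod n = j mod n - 1"
proof -
  have "j mod n = (j - 1) mod n + 1" using mod_add_one[of n "j - 1"] assms by (metis diff_add_cancel)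
  then show ?thesis by linarith
qed

text \<open>As long as the deleted letters do not cross the wrap-around point, the position moves
  strictly in one direction; hence no cancellation is created, and a word that collapses to the
  empty word ends at a different position.\<close>

lemma collapse_forward:
  assumes "n \<ge> 0" "reduced w" "w \<noteq> []" "hd w = (x, True)"
  shows "(collapse x n j w = [] \<longrightarrow> (j + exponent_sum x w) mod n > j mod n) \<and>
    (collapse x n j w \<noteq> [] \<longrightarrow> hd (collapse x n j w) = (None, True) \<or>
      (\<exists>y i b. hd (collapse x n j w) = (Some (y, i), b) \<and> i > j mod n))"
  using assms(2-)
proof (induction w arbitrary: j)
  case (Cons l w)
  then have l: "l = (x, True)" by simp
  show ?case
  proof (cases "n \<noteq> 0 \<and> n dvd j + 1")
    case False
    have m: "(j + 1) mod n = j mod n + 1" using mod_add_one[of n j] assms False by blast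
    show ?thesis
    proof (cases w)
      case Nil
      then show ?thesis using l False m by simp
    next
      case (Cons k v)
      obtain y b where k: "k = (y, b)" by fastforce
      show ?thesis
      proof (cases "y = x")
        case True
        then have "hd w = (x, True)" using Cons.prems Cons k l by (auto simp: reduced_Cons)
        then have "(collapse x n (j + 1) w = [] \<longrightarrow> ((j + 1) + exponent_sum x w) mod n > (j + 1) mod n) \<and>
          (collapse x n (j + 1) w \<noteq> [] \<longrightarrow> hd (collapse x n (j + 1) w) = (None, True) \<or>
          (\<exists>y i b. hd (collapse x n (j + 1) w) = (Some (y, i), b) \<and> i > (j + 1) mod n))"
          using Cons.prems Cons by (intro Cons.IH) (auto simp: reduced_Cons)
        moreover have "collapse x n j (l # w) = collapse x n (j + 1) w" using l False by simp
        moreover have "j + exponent_sum x (l # w) = j + 1 + exponent_sum x w" using l by simp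
        ultimately show ?thesis using m by (metis less_add_one order_less_trans)
      next
        case False
        then show ?thesis using Cons k l m \<open>\<not> (n \<noteq> 0 \<and> n dvd j + 1)\<close> by auto
      qed
    qed
  qed (use l in auto)
qed simp

lemma collapse_backward:
  assumes "n \<ge> 0" "reduced w" "w \<noteq> []" "hd w = (x, False)"
  shows "(collapse x n j w = [] \<longrightarrow> (j + exponent_sum x w) mod n < j mod n) \<and>
    (collapse x n j w \<noteq> [] \<longrightarrow> hd (collapse x n j w) = (None, False) \<or>
      (\<exists>y i b. hd (collapse x n j w) = (Some (y, i), b) \<and> i < j mod n))"
  using assms(2-)
proof (induction w arbitrary: j)
  case (Cons l w)
  then have l: "l = (x, False)" by simp
  show ?case
  proof (cases "n \<noteq> 0 \<and> n dvd j")
    case False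
    have m: "(j - 1) mod n = j mod n - 1" using mod_diff_one[of n j] assms False by blast
    show ?thesis
    proof (cases w)
      case Nil
      then show ?thesis using l False m by simp
    next
      case (Cons k v)
      obtain y b where k: "k = (y, b)" by fastforce
      show ?thesis
      proof (cases "y = x")
        case True
        then have "hd w = (x, False)" using Cons.prems Cons k l by (auto simp: reduced_Cons)
        then have "(collapse x n (j - 1) w = [] \<longrightarrow> ((j - 1) + exponent_sum x w) mod n < (j - 1) mod n) \<and>
          (collapse x n (j - 1) w \<noteq> [] \<longrightarrow> hd (collapse x n (j - 1) w) = (None, False) \<or>
          (\<exists>y i b. hd (collapse x n (j - 1) w) = (Some (y, i), b) \<and> i < (j - 1) mod n))"
          using Cons.prems Cons by (intro Cons.IH) (auto simp: reduced_Cons)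
        moreover have "collapse x n j (l # w) = collapse x n (j - 1) w" using l False by simp
        moreover have "j + exponent_sum x (l # w) = j - 1 + exponent_sum x w" using l by simp
        ultimately show ?thesis using m by (smt (verit))
      next
        case False
        then show ?thesis using Cons k l m \<open>\<not> (n \<noteq> 0 \<and> n dvd j)\<close> by auto
      qed
    qed
  qed (use l in auto)
qed simp

lemma reduced_collapse:
  assumes n: "n \<ge> 0"
  shows "reduced w \<Longrightarrow> reduced (collapse x n j w)"
proof (induction w arbitrary: j)
  case (Cons l w)
  obtain y b where l: "l = (y, b)" by fastforce
  have w: "reduced w" and hd: "w = [] \<or> hd w \<noteq> (y, \<not> b)"
    using Cons.prems l by (auto simp: reduced_Cons)
  note IH = Cons.IH[OF w]
  show ?case
  proof (cases w)
    case Nil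
    then show ?thesis using l by (auto simp: reduced_Cons)
  next
    case (Cons k v)
    obtain z c where k: "k = (z, c)" by fastforce
    have z: "(z, c) \<noteq> (y, \<not> b)" using hd Cons k by simp
    show ?thesis
    proof (cases "z = x")
      case True
      \<comment> \<open>A run of \<open>x\<close> leaves either \<open>None\<close> with the sign of
        the run or a changed tag on the next letter, so the head that surfaces cannot be the inverse
        of the letter before it.\<close>
      have H: "collapse x n i w = [] \<or> hd (collapse x n i w) = (None, c) \<or>
          (\<exists>y j b. hd (collapse x n i w) = (Some (y, j), b) \<and> j \<noteq> i mod n)" for i
        using collapse_forward[OF n w, of x i] collapse_backward[OF n w, of x i] True Cons k
        by (cases c) (force)+
      show ?thesis
      proof (cases "y = x")
        case True
        then have "c = b" using z \<open>z = x\<close> by auto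
        then show ?thesis using l True H[of "j + 1"] H[of "j - 1"] IH[of "j + 1"] IH[of "j - 1"]
          by (cases b) (auto simp: reduced_Cons)
      next
        case False
        then show ?thesis using l H[of j] IH[of j] by (auto simp: reduced_Cons)
      qed
    next
      case False
      then have H: "hd (collapse x n i w) = (Some (z, i mod n), c)" for i using Cons k by simp
      show ?thesis using l z H[of j] H[of "j + 1"] H[of "j - 1"] IH[of j] IH[of "j + 1"] IH[of "j - 1"]
        by (cases "y = x"; cases b) (auto simp: reduced_Cons)
    qed
  qed
qed simp

text \<open>Divisibility brings the path back to its starting position modulo \<open>n\<close>,
  whereas a word that is swallowed completely ends elsewhere.\<close>

lemma collapse_not_Nil:
  assumes "n \<ge> 0" "reduced w" "w \<noteq> []" "n dvd exponent_sum x w"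
  shows "collapse x n j w \<noteq> []"
proof -
  have "(j + exponent_sum x w) mod n = j mod n"
    using assms(4) by (metis add.right_neutral dvd_eq_mod_eq_0 mod_add_right_eq)
  moreover obtain y b v where "w = (y, b) # v" using assms(3) by (cases w) auto
  ultimately show ?thesis
    using collapse_forward[OF assms(1-3), of x j] collapse_backward[OF assms(1-3), of x j]
    by (cases "y = x"; cases b) auto
qed

text \<open>The start keeps the first letter off the wrap-around edge: position 0 for a forward
  step, 1 for a backward one. A cycle with \<open>n = 1\<close> has no other edge.\<close>

lemma collapse_shorter:
  assumes "n \<noteq> 1" "n \<ge> 0" "w = (x, b) # v"
  shows "\<exists>j. length (collapse x n j w) < length w"
proof (cases b)
  case True
  then have "collapse x n 0 w = collapse x n 1 v" using assms by simp
  then show ?thesis using assms length_collapse[of x n 1 v] by (metis le_imp_less_Suc length_Cons)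
next
  case False
  then have "collapse x n 1 w = collapse x n 0 v" using assms by simp
  then show ?thesis using assms length_collapse[of x n 0 v] by (metis le_imp_less_Suc length_Cons)
qed

text \<open>The label of a forward step of \<open>x\<close> that ends at position \<open>j\<close>,
  matching the edge on which \<open>collapse\<close> emits \<open>None\<close>.\<close>

definition wrap :: "int \<Rightarrow> int \<Rightarrow> ('a, 'm) monoid_scheme \<Rightarrow> 'a \<Rightarrow> 'a" where
  "wrap n j G \<alpha> = (if n \<noteq> 0 \<and> n dvd j then \<alpha> else \<one>\<^bsub>G\<^esub>)"

text \<open>The hypotheses say how \<open>\<kappa> j\<close> reads one positive letter in front of
  \<open>v\<close>. The rules for inverse letters follow by applying them to
  \<open>inv g \<otimes> v\<close> and \<open>inv (\<theta> y) \<otimes> v\<close>.\<close>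

lemma (in group) word_value_collapse:
  assumes g: "\<theta> x = g" "g \<in> carrier G"
    and closed: "\<And>j v. v \<in> carrier G \<Longrightarrow> \<kappa> j v \<in> carrier G"
    and one: "\<And>j. \<kappa> j \<one> = \<one>"
    and \<alpha>: "\<alpha> \<in> carrier G"
    and step: "\<And>j v. v \<in> carrier G \<Longrightarrow> \<kappa> j (g \<otimes> v) = wrap n (j + 1) G \<alpha> \<otimes> \<kappa> (j + 1) v"
    and letter: "\<And>j y v. y \<in> Y \<Longrightarrow> y \<noteq> x \<Longrightarrow> v \<in> carrier G \<Longrightarrow> \<kappa> j (\<theta> y \<otimes> v) = d y (j mod n) \<otimes> \<kappa> j v"
    and \<theta>: "\<And>y. y \<in> Y \<Longrightarrow> \<theta> y \<in> carrier G" and d: "\<And>y i. d y i \<in> carrier G"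
  shows "fst ` set w \<subseteq> Y \<Longrightarrow> \<kappa> j (word_value G \<theta> w) =
    word_value G (case_option \<alpha> (case_prod d)) (collapse x n j w)"
proof (induction w arbitrary: j)
  case (Cons l w)
  obtain y b where l: "l = (y, b)" by fastforce
  have y: "y \<in> Y" and w: "word_value G \<theta> w \<in> carrier G"
    using Cons.prems l \<theta> by (auto intro!: word_value_closed)
  have inv_g: "\<kappa> j (inv g \<otimes> v) = inv (wrap n j G \<alpha>) \<otimes> \<kappa> (j - 1) v" if "v \<in> carrier G" for j v
  proof -
    have "\<kappa> (j - 1) v = wrap n j G \<alpha> \<otimes> \<kappa> j (inv g \<otimes> v)"
      using step[of "inv g \<otimes> v" "j - 1"] that g by (simp add: m_assoc[symmetric])
    then show ?thesis
      using that closed \<alpha> g by (simp add: m_assoc[symmetric] wrap_def)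
  qed
  have inv_y: "\<kappa> j (inv (\<theta> y) \<otimes> v) = inv (d y (j mod n)) \<otimes> \<kappa> j v" if "v \<in> carrier G" "y \<noteq> x" for v
  proof -
    have "\<kappa> j v = d y (j mod n) \<otimes> \<kappa> j (inv (\<theta> y) \<otimes> v)"
      using letter[of y "inv (\<theta> y) \<otimes> v" j] that \<theta> y by (simp add: m_assoc[symmetric])
    then show ?thesis
      using that closed d \<theta> y by (simp add: m_assoc[symmetric])
  qed
  have c: "word_value G (case_option \<alpha> (case_prod d)) (collapse x n j w) \<in> carrier G" for j
    using \<alpha> d by (intro word_value_closed) (auto split: option.split)
  show ?case
    using Cons l y w g \<alpha> inv_g[OF w] inv_y[OF w] step[OF w] letter[OF y _ w] c
    by (auto simp: wrap_def)
qed (simp add: one)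

subsection \<open>The descent\<close>

text \<open>This is the property of a subset \<open>B\<close> that drives the descent: every word may be
  evaluated in \<open>K\<close> so that, up to a map preserving \<open>B\<close>, one obtains an arbitrary value of the
  collapsed word.\<close>

definition (in group) collapsing :: "'a set \<Rightarrow> 'a set \<Rightarrow> int \<Rightarrow> bool" where
  "collapsing B K n \<longleftrightarrow> n \<ge> 0 \<and> n \<noteq> 1 \<and> K \<noteq> {} \<and> K \<subseteq> carrier G \<and>
    (\<forall>(x :: nat) l \<alpha> d. \<alpha> \<in> K \<longrightarrow> (\<forall>y i. d y i \<in> K) \<longrightarrow> (\<exists>\<theta> \<kappa>.
      range \<theta> \<subseteq> K \<and>
      (\<forall>j. \<forall>v \<in> carrier G. \<kappa> j v \<in> carrier G) \<and>
      (\<forall>j. \<kappa> j \<one> = \<one>) \<and>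
      (\<forall>j. \<forall>v \<in> carrier G. \<kappa> j (\<theta> x \<otimes> v) = wrap n (j + 1) G \<alpha> \<otimes> \<kappa> (j + 1) v) \<and>
      (\<forall>j. \<forall>y < l. \<forall>v \<in> carrier G. y \<noteq> x \<longrightarrow> \<kappa> j (\<theta> y \<otimes> v) = d y (j mod n) \<otimes> \<kappa> j v) \<and>
      (\<forall>j. \<forall>v \<in> B. \<kappa> j v \<in> B) \<and>
      (\<forall>w. word_value G \<theta> w \<in> B \<longrightarrow> n dvd exponent_sum x w)))"

text \<open>If all values of \<open>u\<close> on \<open>K\<close> lay in \<open>B\<close>, so would
  those of the collapsed word, which is shorter, reduced and, by the divisibility clause,
  non-empty.\<close>

lemma (in group) collapsing_no_law:
  assumes "collapsing B K n" "reduced u" "u \<noteq> []"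
  obtains \<theta> :: "nat \<Rightarrow> 'a" where "range \<theta> \<subseteq> K" "word_value G \<theta> u \<notin> B"
proof -
  have n: "n \<ge> 0" "n \<noteq> 1" and K: "K \<noteq> {}" "K \<subseteq> carrier G"
    using assms(1) by (simp_all add: collapsing_def)
  have "\<exists>\<theta>. range \<theta> \<subseteq> K \<and> word_value G \<theta> u \<notin> B"
    using assms(2,3)
  proof (induction "length u" arbitrary: u rule: less_induct)
    case less
    obtain x b v where u: "u = (x, b) # v" using less.prems by (cases u) auto
    obtain j where j: "length (collapse x n j u) < length u"
      using collapse_shorter[OF n(2,1) u] by blast
    define l where "l = Suc (Max (fst ` set u))"
    have l: "fst ` set u \<subseteq> {..<l}"
      unfolding l_def using Max_ge[of "fst ` set u"] by (simp add: less_Suc_eq_le subset_iff)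
    \<comment> \<open>Recodes the new alphabet by natural numbers, so that the induction hypothesis
      applies.\<close>
    let ?u = "map (apfst to_nat) (collapse x n j u)"
    show ?case
    proof (rule ccontr)
      assume "\<not> ?case"
      then have B: "word_value G \<theta> u \<in> B" if "range \<theta> \<subseteq> K" for \<theta> using that by blast
      have dvd_B: "n dvd exponent_sum x u \<and> word_value G \<theta>' ?u \<in> B"
        if \<theta>': "range \<theta>' \<subseteq> K" for \<theta>'
      proof -
        define \<alpha> where "\<alpha> = \<theta>' (to_nat (None :: (nat \<times> int) option))"
        define d where "d y i = \<theta>' (to_nat (Some (y, i)))" for y :: nat and i :: int
        have \<alpha>: "\<alpha> \<in> K" and d: "\<forall>y i. d y i \<in> K" unfolding \<alpha>_def d_def using \<theta>' by auto
        obtain \<theta> \<kappa> where \<theta>: "range \<theta> \<subseteq> K"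
          and \<kappa>: "\<forall>j. \<forall>v \<in> carrier G. \<kappa> j v \<in> carrier G" "\<forall>j. \<kappa> j \<one> = \<one>"
            "\<forall>j. \<forall>v \<in> carrier G. \<kappa> j (\<theta> x \<otimes> v) = wrap n (j + 1) G \<alpha> \<otimes> \<kappa> (j + 1) v"
            "\<forall>j. \<forall>y < l. \<forall>v \<in> carrier G. y \<noteq> x \<longrightarrow> \<kappa> j (\<theta> y \<otimes> v) = d y (j mod n) \<otimes> \<kappa> j v"
            "\<forall>j. \<forall>v \<in> B. \<kappa> j v \<in> B"
            "\<forall>w. word_value G \<theta> w \<in> B \<longrightarrow> n dvd exponent_sum x w"
          using assms(1) \<alpha> d unfolding collapsing_def by (smt (verit, ccfv_threshold))
        have closed: "\<alpha> \<in> carrier G" "\<theta> y \<in> carrier G" "d y i \<in> carrier G" for y i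
          using \<theta> \<alpha> d K by auto
        have "\<kappa> j (word_value G \<theta> u) = word_value G (case_option \<alpha> (case_prod d)) (collapse x n j u)"
          by (rule word_value_collapse[where Y = "{..<l}" and g = "\<theta> x"])
            (use closed \<kappa> l in auto)
        moreover have "case_option \<alpha> (case_prod d) = \<theta>' \<circ> to_nat"
          unfolding \<alpha>_def d_def by (auto simp: fun_eq_iff split: option.split)
        ultimately have "\<kappa> j (word_value G \<theta> u) = word_value G \<theta>' ?u"
          by (simp add: word_value_map)
        then show ?thesis using B[OF \<theta>] \<kappa>(5,6) by metis
      qed
      \<comment> \<open>Divisibility does not mention \<open>\<theta>'\<close>, so any constant
        assignment extracts it.\<close>
      obtain k where "k \<in> K" using K by blast
      then have "n dvd exponent_sum x u" using dvd_B[of "\<lambda>_. k"] by simp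
      then have "?u \<noteq> []" using collapse_not_Nil[OF n(1) less.prems] by simp
      moreover have "reduced ?u"
        using reduced_collapse[OF n(1) less.prems(1)] by (simp add: reduced_map)
      moreover have "length ?u < length u" using j by simp
      ultimately obtain \<theta>' where "range \<theta>' \<subseteq> K" "word_value G \<theta>' ?u \<notin> B"
        using less.hyps[of ?u] by blast
      then show False using dvd_B by blast
    qed
  qed
  then show ?thesis using that by blast
qed

section \<open>Orders of elements and exponent sums modulo a subgroup\<close>

text \<open>The exponents that lead into \<open>M\<close> form a subgroup of the integers; infinite
  order modulo \<open>M\<close> is encoded as \<open>n = 0\<close>.\<close>

lemma (in group) int_pow_mem_subgroup:
  assumes "subgroup M G" "a \<in> carrier G"
  obtains n :: int where "n \<ge> 0" "\<And>e :: int. a [^] e \<in> M \<longleftrightarrow> n dvd e"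
proof (cases "\<exists>e :: int. e > 0 \<and> a [^] e \<in> M")
  case False
  have "e = 0" if "a [^] e \<in> M" for e :: int
  proof -
    have "a [^] (- e) \<in> M"
      using that assms by (simp add: int_pow_neg subgroup.m_inv_closed)
    then show ?thesis using False that by (metis neg_0_less_iff_less linorder_neqE_linordered_idom)
  qed
  then have "a [^] e \<in> M \<longleftrightarrow> (0 :: int) dvd e" for e
    using subgroup.one_closed[OF assms(1)] by auto
  then show ?thesis using that[of 0] by simp
next
  case True
  then obtain e0 :: int where "e0 > 0" "a [^] e0 \<in> M" by blast
  then have ex: "nat e0 > 0 \<and> a [^] int (nat e0) \<in> M" by simp
  define k where "k = (LEAST k :: nat. k > 0 \<and> a [^] int k \<in> M)"
  have k: "k > 0" "a [^] int k \<in> M" and min: "\<And>l. l > 0 \<Longrightarrow> a [^] int l \<in> M \<Longrightarrow> k \<le> l"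
    unfolding k_def using LeastI[of "\<lambda>k :: nat. k > 0 \<and> a [^] int k \<in> M", OF ex]
    by (auto intro: Least_le)
  have mult: "a [^] (int k * q) \<in> M" for q :: int
    using subgroup_int_pow_closed[OF assms(1) k(2), of q] assms by (simp add: int_pow_pow)
  have "a [^] e \<in> M \<longleftrightarrow> int k dvd e" for e :: int
  proof
    assume e: "a [^] e \<in> M"
    have eq: "a [^] (e mod int k) = a [^] e \<otimes> a [^] (int k * (- (e div int k)))"
      using assms by (simp add: int_pow_mult[symmetric] minus_mult_div_eq_mod[symmetric])
    have "a [^] (e mod int k) \<in> M"
      unfolding eq by (rule subgroup.m_closed[OF assms(1) e mult])
    then have "a [^] int (nat (e mod int k)) \<in> M" using k by simp
    moreover have "nat (e mod int k) < k" using k by (simp add: nat_less_iff)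
    ultimately have "nat (e mod int k) = 0" using min[of "nat (e mod int k)"] by linarith
    moreover have "e mod int k \<ge> 0" using k by simp
    ultimately show "int k dvd e" by (simp add: dvd_eq_mod_eq_0)
  qed (use mult in auto)
  then show ?thesis using that[of "int k"] by simp
qed

text \<open>Modulo \<open>H\<close> every letter except \<open>x\<close> becomes trivial, so only a
  power of \<open>a\<close> survives.\<close>

lemma (in normal) word_value_int_pow:
  assumes "\<theta> x = a" "a \<in> carrier G" "\<And>y. y \<noteq> x \<Longrightarrow> \<theta> y \<in> H"
  shows "word_value G \<theta> w \<otimes> a [^] (- exponent_sum x w) \<in> H"
proof (induction w)
  case (Cons l w)
  obtain y b where l: "l = (y, b)" by fastforce
  have \<theta>: "\<theta> y \<in> carrier G" for y using assms by (cases "y = x") auto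
  have w: "word_value G \<theta> w \<in> carrier G" using \<theta> by (auto intro!: word_value_closed)
  let ?e = "exponent_sum x w"
  show ?case
  proof (cases "y = x")
    case False
    then have "(if b then \<theta> y else inv (\<theta> y)) \<otimes> (word_value G \<theta> w \<otimes> a [^] (- ?e)) \<in> H"
      using Cons assms by auto
    then show ?thesis using l False w \<theta> assms by (auto simp: m_assoc)
  next
    case True
    let ?g = "if b then a else inv a"
    have g: "?g \<in> carrier G" using assms by simp
    have e: "a [^] (- exponent_sum x (l # w)) = a [^] (- ?e) \<otimes> inv ?g"
    proof (cases b)
      case b: True
      then have "- exponent_sum x (l # w) = - ?e + (- 1)" using l True by simp
      then have "a [^] (- exponent_sum x (l # w)) = a [^] (- ?e) \<otimes> a [^] (- 1 :: int)"
        using assms(2) by (simp only: int_pow_mult)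
      then show ?thesis using b assms by (simp add: int_pow_neg)
    next
      case b: False
      then have "- exponent_sum x (l # w) = - ?e + 1" using l True by simp
      then have "a [^] (- exponent_sum x (l # w)) = a [^] (- ?e) \<otimes> a [^] (1 :: int)"
        using assms(2) by (simp only: int_pow_mult)
      then show ?thesis using b assms by simp
    qed
    have "?g \<otimes> (word_value G \<theta> w \<otimes> a [^] (- ?e)) \<otimes> inv ?g \<in> H"
      using Cons.IH g by (rule inv_op_closed2[rotated])
    moreover have "word_value G \<theta> (l # w) = ?g \<otimes> word_value G \<theta> w" using l True assms by simp
    ultimately show ?thesis using e w g assms by (simp add: m_assoc)
  qed
qed simp

text \<open>Supplies the divisibility clause of \<open>collapsing\<close>, where a value in
  \<open>B\<close> is in particular a value in \<open>M\<close>.\<close>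

lemma (in normal) word_value_mem_imp_dvd:
  assumes "\<theta> x = a" "a \<in> carrier G" "\<And>y. y \<noteq> x \<Longrightarrow> \<theta> y \<in> H"
    and dvd: "\<And>e :: int. a [^] e \<in> H \<Longrightarrow> n dvd e" and w: "word_value G \<theta> w \<in> H"
  shows "n dvd exponent_sum x w"
proof -
  have "inv (word_value G \<theta> w) \<otimes> (word_value G \<theta> w \<otimes> a [^] (- exponent_sum x w)) \<in> H"
    using word_value_int_pow[of \<theta> x a w] assms by simp
  moreover have "word_value G \<theta> w \<in> carrier G" using w by simp
  ultimately have "a [^] (- exponent_sum x w) \<in> H"
    using assms by (simp add: m_assoc[symmetric])
  then show ?thesis using dvd by fastforce
qed

lemma (in group) hom_eq_on_generate:
  assumes "h \<in> hom G G'" "k \<in> hom G G'" "group G'" "A \<subseteq> carrier G"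
    and "\<And>x. x \<in> A \<Longrightarrow> h x = k x" "g \<in> generate G A"
  shows "h g = k g"
proof -
  interpret h: group_hom G G' h
    using assms by (intro group_hom.intro group_hom_axioms.intro is_group)
  interpret k: group_hom G G' k
    using assms by (intro group_hom.intro group_hom_axioms.intro is_group)
  have sub: "generate G A \<subseteq> carrier G" using assms(4) by (rule generate_incl)
  show ?thesis using assms(6)
  proof induction
    case (eng g1 g2)
    then show ?case using sub by (metis h.hom_mult k.hom_mult subsetD)
  qed (use assms(4,5) in auto)
qed

lemma (in group) hom_generate_in_subgroup:
  assumes "h \<in> hom G G'" "group G'" "A \<subseteq> carrier G" "subgroup L G'"
    and "\<And>x. x \<in> A \<Longrightarrow> h x \<in> L" "g \<in> generate G A"
  shows "h g \<in> L"
proof -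
  interpret h: group_hom G G' h
    using assms by (intro group_hom.intro group_hom_axioms.intro is_group)
  have sub: "generate G A \<subseteq> carrier G" using assms(3) by (rule generate_incl)
  show ?thesis using assms(6)
  proof induction
    case (eng g1 g2)
    then have "g1 \<in> carrier G" "g2 \<in> carrier G" using sub by auto
    then show ?case using eng subgroup.m_closed[OF assms(4)] by (metis h.hom_mult)
  next
    case (inv g)
    then show ?case using assms(3,5) subgroup.m_inv_closed[OF assms(4)] by (metis h.hom_inv subsetD)
  qed (use assms(3,4,5) in \<open>auto simp: subgroup.one_closed\<close>)
qed

subsection \<open>Labellings of the Cayley graph\<close>

text \<open>\<open>B\<close> will be the verbal subgroup of \<open>F\<close>. Keeping it abstract
  allows the same constructions with a trivial \<open>B\<close> and the kernel of an endomorphism as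
  \<open>M\<close>.\<close>

locale preserved_subset = free_on F S for F (structure) and S +
  fixes M B
  assumes normal: "M \<lhd> F"
    and B_M: "B \<subseteq> M"
    and hom_B: "\<And>h. h \<in> hom (F\<lparr>carrier := M\<rparr>) F \<Longrightarrow> h ` B \<subseteq> B"
begin

lemma M_subgroup: "subgroup M F"
  using normal by (simp add: normal_def)

lemma M_carrier: "M \<subseteq> carrier F"
  using M_subgroup by (rule subgroup.subset)

lemma M_closed [simp]: "y \<in> M \<Longrightarrow> y \<in> carrier F"
  using M_carrier by blast

lemma M_one [simp]: "\<one> \<in> M"
  using M_subgroup by (rule subgroup.one_closed)

lemma M_mult [simp]: "y \<in> M \<Longrightarrow> z \<in> M \<Longrightarrow> y \<otimes> z \<in> M"
  using M_subgroup by (rule subgroup.m_closed)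

lemma M_inv [simp]: "y \<in> M \<Longrightarrow> inv y \<in> M"
  using M_subgroup by (rule subgroup.m_inv_closed)

lemma M_conj: "y \<in> M \<Longrightarrow> x \<in> carrier F \<Longrightarrow> x \<otimes> y \<otimes> inv x \<in> M"
  using normal.inv_op_closed2[OF normal] by blast

lemma M_conj': "y \<in> M \<Longrightarrow> x \<in> carrier F \<Longrightarrow> inv x \<otimes> y \<otimes> x \<in> M"
  using normal.inv_op_closed1[OF normal] by blast

lemma M_mult_cancel: "y \<in> M \<Longrightarrow> x \<in> carrier F \<Longrightarrow> y \<otimes> x \<in> M \<longleftrightarrow> x \<in> M"
  using M_mult[of "inv y" "y \<otimes> x"] by (auto simp: m_assoc[symmetric])

text \<open>Labels that are constant on the cosets of \<open>M\<close> describe an action of the free group on a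
  wreath product over \<open>F / M\<close>; on \<open>M\<close> each coordinate of it is a homomorphism.\<close>

context
  fixes f :: "'a \<Rightarrow> 'a \<Rightarrow> 'a"
  assumes f: "\<And>x s. x \<in> carrier F \<Longrightarrow> s \<in> S \<Longrightarrow> f x s \<in> carrier F"
    and f_M: "\<And>x y s. x \<in> carrier F \<Longrightarrow> y \<in> M \<Longrightarrow> s \<in> S \<Longrightarrow> f (y \<otimes> x) s = f x s"
begin

lemma cocycle_coset:
  "y \<in> M \<Longrightarrow> x \<in> carrier F \<Longrightarrow> g \<in> carrier F \<Longrightarrow> cocycle f (y \<otimes> x) g = cocycle f x g"
  by (rule cocycle_shift) (auto simp: f f_M)

text \<open>Normality of \<open>M\<close> turns right translation into left translation.\<close>

lemma cocycle_coset_right: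
  assumes "y \<in> M" "x \<in> carrier F" "g \<in> carrier F"
  shows "cocycle f (x \<otimes> y) g = cocycle f x g"
proof -
  have "x \<otimes> y = (x \<otimes> y \<otimes> inv x) \<otimes> x" using assms by (simp add: m_assoc)
  then show ?thesis using cocycle_coset M_conj assms by metis
qed

text \<open>The path of \<open>y\<close> ends in the coset where it began, so the path of
  \<open>g\<close> then meets the same labels as from \<open>x\<close>.\<close>

lemma cocycle_M_mult:
  "y \<in> M \<Longrightarrow> x \<in> carrier F \<Longrightarrow> g \<in> carrier F \<Longrightarrow>
    cocycle f x (y \<otimes> g) = cocycle f x y \<otimes> cocycle f x g"
  using cocycle_mult[of f x y g] cocycle_coset_right[of y x g] f by simp

lemma cocycle_B: "x \<in> carrier F \<Longrightarrow> v \<in> B \<Longrightarrow> cocycle f x v \<in> B"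
proof -
  assume x: "x \<in> carrier F" and v: "v \<in> B"
  have "cocycle f x \<in> hom (F\<lparr>carrier := M\<rparr>) F"
    using x by (intro homI) (auto simp: cocycle_M_mult cocycle_closed f)
  then show "cocycle f x v \<in> B" using hom_B v by blast
qed

end

text \<open>The exponent of \<open>a\<close> in a coset of \<open>M\<close> that contains a power of
  \<open>a\<close>. It is meaningful only for such cosets and only modulo the order of
  \<open>a\<close>, so its uses reduce it modulo \<open>n\<close>.\<close>

definition coset_index :: "'a \<Rightarrow> 'a \<Rightarrow> int" where
  "coset_index a x = (SOME i. x \<otimes> a [^] (- i) \<in> M)"

lemma coset_cyclic_shift:
  assumes "y \<in> M" "x \<in> carrier F" "a \<in> carrier F"
  shows "y \<otimes> x \<otimes> a [^] (i :: int) \<in> M \<longleftrightarrow> x \<otimes> a [^] i \<in> M"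
  using M_mult_cancel[of y "x \<otimes> a [^] i"] assms by (simp add: m_assoc)

lemma coset_index_shift:
  assumes "y \<in> M" "x \<in> carrier F" "a \<in> carrier F"
  shows "coset_index a (y \<otimes> x) = coset_index a x"
  unfolding coset_index_def using coset_cyclic_shift[OF assms] by simp

lemma coset_index_pow:
  assumes "a \<in> carrier F" "\<And>e :: int. a [^] e \<in> M \<longleftrightarrow> n dvd e"
  shows "coset_index a (a [^] j) mod n = j mod n"
proof -
  have "a [^] j \<otimes> a [^] (- j) \<in> M" using assms(1) by (simp add: int_pow_mult[symmetric])
  then have "a [^] j \<otimes> a [^] (- coset_index a (a [^] j)) \<in> M"
    unfolding coset_index_def by (rule someI)
  then have "n dvd j - coset_index a (a [^] j)"
    using assms by (simp add: int_pow_mult[symmetric])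
  then show ?thesis by (metis mod_eq_dvd_iff)
qed

text \<open>\<open>a\<close> and \<open>m\<close> behave like part of a free basis: \<open>\<alpha>\<close> is the image of \<open>a [^] n\<close>, and
  \<open>\<mu> j\<close> is the image of the conjugate of \<open>m\<close> by \<open>a [^] j\<close>.\<close>

definition independent :: "int \<Rightarrow> 'a \<Rightarrow> 'a \<Rightarrow> bool" where
  "independent n a m \<longleftrightarrow> (\<forall>\<alpha> \<mu>. \<alpha> \<in> carrier F \<longrightarrow> (\<forall>i. \<mu> i \<in> carrier F) \<longrightarrow> (\<exists>\<kappa>.
    (\<forall>j. \<forall>v \<in> carrier F. \<kappa> j v \<in> carrier F) \<and>
    (\<forall>j. \<forall>y \<in> M. \<forall>v \<in> carrier F. \<kappa> j (y \<otimes> v) = \<kappa> j y \<otimes> \<kappa> j v) \<and>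
    (\<forall>j e. \<forall>v \<in> carrier F. \<kappa> j (a [^] (e :: int) \<otimes> v) = \<kappa> j (a [^] e) \<otimes> \<kappa> (j + e) v) \<and>
    (\<forall>j. \<kappa> j a = wrap n (j + 1) F \<alpha>) \<and>
    (\<forall>j. \<kappa> j m = \<mu> (j mod n)) \<and>
    (\<forall>j. \<forall>v \<in> B. \<kappa> j v \<in> B)))"

text \<open>Take the least \<open>k > 0\<close> for which \<open>b [^] k\<close> times a power of
  \<open>a\<close> lies in \<open>M\<close>; this product is \<open>m\<close>. On its path from
  \<open>a [^] j\<close> only the first \<open>b\<close>-edge starts in a coset of a power of
  \<open>a\<close>, so that edge can be labelled freely for each residue of
  \<open>j\<close>.\<close>

lemma independent_pair:
  assumes a: "a \<in> S" and b: "b \<in> S" "a \<noteq> b"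
    and n: "n > 0" "\<And>e :: int. a [^] e \<in> M \<longleftrightarrow> n dvd e"
    and l: "(l :: nat) > 0" "b [^] l \<in> M"
  obtains m where "m \<in> M" "m \<in> generate F {a, b}" "independent n a m"
proof -
  have ac: "a \<in> carrier F" and bc: "b \<in> carrier F" using a b by auto
  define P where "P k \<longleftrightarrow> k > 0 \<and> (\<exists>e :: nat. b [^] k \<otimes> a [^] e \<in> M)" for k :: nat
  have "P l" unfolding P_def using l bc by (auto intro!: exI[of _ 0])
  define k where "k = (LEAST k. P k)"
  have "P k" unfolding k_def using \<open>P l\<close> by (rule LeastI)
  then obtain e :: nat where k: "k > 0" and m: "b [^] k \<otimes> a [^] e \<in> M" unfolding P_def by blast
  define m where "m = b [^] k \<otimes> a [^] e"
  have min: "\<not> (b [^] t \<otimes> a [^] (i :: int) \<in> M)" if t: "0 < t" "t < k" for t i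
  proof
    assume i: "b [^] t \<otimes> a [^] i \<in> M"
    \<comment> \<open>Powers of \<open>a\<close> matter only modulo \<open>n\<close>, so
      \<open>i\<close> can be replaced by the natural exponent that \<open>P\<close>
      requires.\<close>
    have "a [^] (n * (- (i div n))) \<in> M" using n by simp
    then have "b [^] t \<otimes> a [^] i \<otimes> a [^] (n * (- (i div n))) \<in> M" using i by simp
    moreover have "a [^] i \<otimes> a [^] (n * (- (i div n))) = a [^] (i mod n)"
      using ac by (simp add: int_pow_mult[symmetric] minus_mult_div_eq_mod)
    moreover have "a [^] (i mod n) = a [^] nat (i mod n)"
      using n by (metis int_nat_eq int_pow_int pos_mod_sign)
    ultimately have "b [^] t \<otimes> a [^] nat (i mod n) \<in> M" using ac bc by (simp add: m_assoc)
    then have "P t" unfolding P_def using t by blast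
    then show False using not_less_Least t unfolding k_def by blast
  qed
  have "independent n a m"
    unfolding independent_def
  proof (intro allI impI)
    fix \<alpha> \<mu> assume \<alpha>: "\<alpha> \<in> carrier F" and \<mu>: "\<forall>i :: int. \<mu> i \<in> carrier F"
    \<comment> \<open>Non-trivial labels sit only on the \<open>a\<close>-edges that enter
      \<open>M\<close> and on the \<open>b\<close>-edges that leave cosets of powers of
      \<open>a\<close>.\<close>
    define f where "f \<beta> x s = (if s = a then (if x \<otimes> a [^] (1 :: int) \<in> M then \<alpha> else \<one>)
      else if s = b \<and> (\<exists>i :: int. x \<otimes> a [^] (- i) \<in> M) then \<beta> (coset_index a x mod n) else \<one>)"
      for \<beta> :: "int \<Rightarrow> 'a" and x s
    have f: "f \<beta> x s \<in> carrier F" if "\<forall>i. \<beta> i \<in> carrier F" for \<beta> x s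
      unfolding f_def using \<alpha> that by simp
    have f_M: "f \<beta> (y \<otimes> x) s = f \<beta> x s" if "x \<in> carrier F" "y \<in> M" for \<beta> x y s
      unfolding f_def using that ac by (simp only: coset_cyclic_shift coset_index_shift)
    \<comment> \<open>The final factor \<open>a [^] e\<close> of \<open>m\<close> contributes
      \<open>\<gamma> j\<close>, which involves only labels of \<open>a\<close>-edges;
      \<open>\<beta>\<close> compensates for it in advance.\<close>
    define \<gamma> where "\<gamma> j = cocycle (f (\<lambda>_. \<one>)) (a [^] j \<otimes> b [^] k) (a [^] e)" for j :: int
    define \<beta> where "\<beta> i = \<mu> i \<otimes> inv (\<gamma> i)" for i
    have f1: "f (\<lambda>_. \<one>) x s \<in> carrier F" for x s by (rule f) simp
    have \<gamma>: "\<gamma> j \<in> carrier F" for j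
      unfolding \<gamma>_def using ac bc by (intro cocycle_closed f1) auto
    have \<beta>: "\<forall>i. \<beta> i \<in> carrier F" unfolding \<beta>_def using \<mu> \<gamma> by simp
    note f\<beta> = f[OF \<beta>]
    let ?c = "cocycle (f \<beta>)"
    have \<gamma>_mod: "\<gamma> (j mod n) = \<gamma> j" for j
    proof -
      have "a [^] (n * (j div n)) \<in> M" using n by simp
      moreover have "a [^] (n * (j div n)) \<otimes> (a [^] (j mod n) \<otimes> b [^] k) = a [^] j \<otimes> b [^] k"
        using ac bc by (simp add: m_assoc[symmetric] int_pow_mult[symmetric])
      ultimately show ?thesis
        unfolding \<gamma>_def using cocycle_coset[of "f (\<lambda>_. \<one>)" "a [^] (n * (j div n))" "a [^] (j mod n) \<otimes> b [^] k" "a [^] e"] ac bc f1 f_M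
        by simp
    qed
    have pow_a: "?c x (a [^] t) = cocycle (f (\<lambda>_. \<one>)) x (a [^] t)" if "x \<in> carrier F" for x and t :: nat
    proof (induction t)
      case 0
      then show ?case using that by (simp add: cocycle_one f\<beta> f1)
    next
      case (Suc t)
      have "f \<beta> y a = f (\<lambda>_. \<one>) y a" for y by (simp add: f_def)
      then show ?case using Suc that ac a
        by (simp add: cocycle_mult f\<beta> f1 cocycle_basis)
    qed
    \<comment> \<open>By minimality of \<open>k\<close>, the later \<open>b\<close>-edges start
      outside the cosets of powers of \<open>a\<close>.\<close>
    have pow_b: "?c (a [^] j \<otimes> b [^] t) (b [^] r) = \<one>" if "0 < t" "t + r \<le> k" for j :: int and t r
      using that
    proof (induction r)
      case 0
      then show ?case using ac bc by (simp add: cocycle_one f\<beta>)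
    next
      case (Suc r)
      let ?x = "a [^] j \<otimes> b [^] (t + r)"
      have "?x \<otimes> a [^] (- i) \<notin> M" for i :: int
      proof
        assume "?x \<otimes> a [^] (- i) \<in> M"
        then have "inv (a [^] j) \<otimes> (?x \<otimes> a [^] (- i)) \<otimes> a [^] j \<in> M"
          using ac by (intro M_conj') auto
        also have "inv (a [^] j) \<otimes> (?x \<otimes> a [^] (- i)) \<otimes> a [^] j = b [^] (t + r) \<otimes> a [^] (- i + j)"
          using ac bc by (simp only: int_pow_mult m_assoc[symmetric] m_closed int_pow_closed nat_pow_closed inv_closed l_inv l_one)
        finally show False using min[of "t + r" "- i + j"] Suc.prems by auto
      qed
      then have "f \<beta> ?x b = \<one>" using b by (auto simp: f_def)
      moreover have "?c (a [^] j \<otimes> b [^] t) (b [^] Suc r) =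
          ?c (a [^] j \<otimes> b [^] t) (b [^] r) \<otimes> ?c (a [^] j \<otimes> b [^] t \<otimes> b [^] r) b"
        using ac bc f\<beta> by (simp add: cocycle_mult)
      moreover have "a [^] j \<otimes> b [^] t \<otimes> b [^] r = ?x"
        using ac bc by (simp add: m_assoc nat_pow_mult)
      ultimately show ?case using Suc ac bc b f\<beta> by (simp add: cocycle_basis)
    qed
    have c_m: "?c (a [^] j) m = \<mu> (j mod n)" for j
    proof -
      obtain k' where k': "k = Suc k'" using k by (cases k) auto
      have "b [^] k = b \<otimes> b [^] k'" unfolding k' by (rule nat_pow_Suc2[OF bc])
      then have "?c (a [^] j) (b [^] k) = ?c (a [^] j) b \<otimes> ?c (a [^] j \<otimes> b) (b [^] k')"
        using ac bc f\<beta> by (simp add: cocycle_mult)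
      also have "?c (a [^] j \<otimes> b) (b [^] k') = \<one>" using pow_b[of 1 k' j] k' bc by simp
      also have "?c (a [^] j) b = f \<beta> (a [^] j) b" using ac b f\<beta> by (simp add: cocycle_basis)
      also have "f \<beta> (a [^] j) b = \<beta> (j mod n)"
      proof -
        have "a [^] j \<otimes> a [^] (- j) \<in> M" using ac by (simp add: int_pow_mult[symmetric])
        then show ?thesis using b coset_index_pow[OF ac n(2), of j] by (auto simp: f_def)
      qed
      finally have 1: "?c (a [^] j) (b [^] k) = \<beta> (j mod n)" using \<beta> by simp
      have "?c (a [^] j \<otimes> b [^] k) (a [^] e) = \<gamma> j"
        unfolding \<gamma>_def using ac bc by (intro pow_a) simp
      then have "?c (a [^] j) m = \<beta> (j mod n) \<otimes> \<gamma> j"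
        unfolding m_def using 1 ac bc f\<beta> by (simp add: cocycle_mult)
      then show ?thesis unfolding \<beta>_def using \<gamma> \<mu> by (simp add: m_assoc \<gamma>_mod)
    qed
    show "\<exists>\<kappa>. (\<forall>j. \<forall>v \<in> carrier F. \<kappa> j v \<in> carrier F) \<and>
      (\<forall>j. \<forall>y \<in> M. \<forall>v \<in> carrier F. \<kappa> j (y \<otimes> v) = \<kappa> j y \<otimes> \<kappa> j v) \<and>
      (\<forall>j e. \<forall>v \<in> carrier F. \<kappa> j (a [^] (e :: int) \<otimes> v) = \<kappa> j (a [^] e) \<otimes> \<kappa> (j + e) v) \<and>
      (\<forall>j. \<kappa> j a = wrap n (j + 1) F \<alpha>) \<and> (\<forall>j. \<kappa> j m = \<mu> (j mod n)) \<and>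
      (\<forall>j. \<forall>v \<in> B. \<kappa> j v \<in> B)"
    proof (intro exI[of _ "\<lambda>j :: int. ?c (a [^] j)"] conjI allI ballI)
      fix j :: int
      show "?c (a [^] j) v \<in> carrier F" if "v \<in> carrier F" for v
        using that ac f\<beta> by (intro cocycle_closed) auto
      show "?c (a [^] j) (y \<otimes> v) = ?c (a [^] j) y \<otimes> ?c (a [^] j) v" if "v \<in> carrier F" "y \<in> M" for v y
        using that ac f\<beta> f_M by (intro cocycle_M_mult) auto
      show "?c (a [^] j) (a [^] e \<otimes> v) = ?c (a [^] j) (a [^] e) \<otimes> ?c (a [^] (j + e)) v"
        if "v \<in> carrier F" for v and e :: int
        using that ac f\<beta> by (simp add: cocycle_mult int_pow_mult)
      show "?c (a [^] j) a = wrap n (j + 1) F \<alpha>"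
      proof -
        have "a [^] j \<otimes> a \<in> M \<longleftrightarrow> n dvd j + 1"
          using n(2)[of "j + 1"] ac by (simp add: int_pow_mult)
        then have "f \<beta> (a [^] j) a = wrap n (j + 1) F \<alpha>"
          using ac n(1) by (simp add: f_def wrap_def)
        then show ?thesis using ac a f\<beta> by (simp add: cocycle_basis)
      qed
      show "?c (a [^] j) v \<in> B" if "v \<in> B" for v
        using that ac f\<beta> f_M by (intro cocycle_B) auto
    qed (rule c_m)
  qed
  moreover have "m \<in> generate F {a, b}"
  proof -
    have g: "subgroup (generate F {a, b}) F" using ac bc by (intro generate_is_subgroup) auto
    have "a \<in> generate F {a, b}" "b \<in> generate F {a, b}" by (auto intro: generate.incl)
    then have "b [^] int k \<in> generate F {a, b}" "a [^] int e \<in> generate F {a, b}"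
      using g by (auto intro: subgroup_int_pow_closed)
    then show ?thesis unfolding m_def using g by (simp add: int_pow_int subgroup.m_closed)
  qed
  ultimately show ?thesis using that m unfolding m_def by blast
qed

end

context preserved_subset
begin

lemma independentE:
  assumes "independent n a m" "\<alpha> \<in> carrier F" "\<And>i. \<mu> i \<in> carrier F"
  obtains \<kappa> where "\<forall>j. \<forall>v \<in> carrier F. \<kappa> j v \<in> carrier F"
    and "\<forall>j. \<forall>y \<in> M. \<forall>v \<in> carrier F. \<kappa> j (y \<otimes> v) = \<kappa> j y \<otimes> \<kappa> j v"
    and "\<forall>j e. \<forall>v \<in> carrier F. \<kappa> j (a [^] (e :: int) \<otimes> v) = \<kappa> j (a [^] e) \<otimes> \<kappa> (j + e) v"
    and "\<forall>j. \<kappa> j a = wrap n (j + 1) F \<alpha>"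
    and "\<forall>j. \<kappa> j m = \<mu> (j mod n)"
    and "\<forall>j. \<forall>v \<in> B. \<kappa> j v \<in> B"
proof -
  have "\<forall>i. \<mu> i \<in> carrier F" using assms(3) by blast
  from assms(1)[unfolded independent_def, THEN spec, THEN spec, THEN mp, THEN mp, OF assms(2) this]
  show thesis by (elim exE conjE) (rule that)
qed

text \<open>Conjugation by \<open>a [^] (- int t)\<close> moves an element visible only in
  coordinate 0 to coordinate \<open>t\<close>. The product thus places the code of
  \<open>d (int t)\<close> in each coordinate \<open>t\<close>.\<close>

fun spread :: "'a \<Rightarrow> ('a \<Rightarrow> 'a) \<Rightarrow> (int \<Rightarrow> 'a) \<Rightarrow> nat \<Rightarrow> 'a" where
  "spread a \<rho> d 0 = \<one>"
| "spread a \<rho> d (Suc t) = spread a \<rho> d t \<otimes> (a [^] (- int t) \<otimes> \<rho> (d (int t)) \<otimes> a [^] int t)"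

text \<open>One homomorphism on \<open>M\<close> is not enough here, since \<open>m\<close> has only \<open>n\<close> independent conjugates.
  The first one sends \<open>a [^] n\<close> to \<open>m\<close> and \<open>m\<close> to \<open>a\<close>, with the other conjugates of \<open>m\<close> sent to
  \<open>\<one>\<close>. The words \<open>e1\<close> and \<open>e2\<close> below are then visible in coordinate \<open>0\<close> only, where they
  become the elements \<open>a [^] n\<close> and \<open>z2\<close> of \<open>M\<close>. Together with \<open>m\<close> these are independent, so a
  second homomorphism maps them to \<open>a\<close>, \<open>b\<close> and \<open>\<alpha>\<close>.\<close>

lemma independent_collapsing:
  assumes a: "a \<in> S" and b: "b \<in> S" "a \<noteq> b"
    and n: "n \<ge> 2" "\<And>e :: int. a [^] e \<in> M \<longleftrightarrow> n dvd e"
    and m: "m \<in> M" "m \<in> generate F {a, b}" and ind: "independent n a m"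
  shows "collapsing B (generate F {a, b}) n"
proof -
  let ?K = "generate F {a, b}"
  have ac: "a \<in> carrier F" and bc: "b \<in> carrier F" using a b by auto
  have K: "subgroup ?K F" using ac bc by (intro generate_is_subgroup) auto
  have aK: "a \<in> ?K" and bK: "b \<in> ?K" by (auto intro: generate.incl)
  have KF: "?K \<subseteq> carrier F" using K by (rule subgroup.subset)
  have mc: "m \<in> carrier F" using m by simp
  have an: "a [^] n \<in> M" using n by simp
  \<comment> \<open>The first homomorphism sees \<open>m\<close> only in coordinate 0, but
    \<open>a [^] n\<close> crosses the labelled edge from every coordinate. The commutator
    \<open>e2\<close> with \<open>m\<close> confines it to coordinate 0.\<close>
  define e1 where "e1 = m [^] n"
  define e2 where "e2 = a [^] n \<otimes> m \<otimes> inv (a [^] n) \<otimes> inv m"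
  define z2 where "z2 = m \<otimes> (a \<otimes> inv m \<otimes> inv a)"
  have e1: "e1 \<in> M" "e1 \<in> ?K" unfolding e1_def
    using m K M_subgroup by (auto intro: subgroup_int_pow_closed)
  have e2: "e2 \<in> M" unfolding e2_def using m an by simp
  have "a [^] n \<in> ?K" using aK K by (rule subgroup_int_pow_closed[rotated])
  then have e2K: "e2 \<in> ?K" unfolding e2_def
    using m K by (auto intro!: subgroup.m_closed subgroup.m_inv_closed)
  have z2: "z2 \<in> M" unfolding z2_def using m ac by (intro M_mult M_conj) auto
  \<comment> \<open>\<open>\<rho> h\<close> is a code for \<open>h\<close>: coordinate 0 of the
    first homomorphism turns it into \<open>\<rho>' h\<close>, and the second one recovers
    \<open>h\<close>. This works for \<open>h\<close> in the subgroup generated by \<open>a\<close>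
    and \<open>b\<close>, hence the choice of \<open>?K\<close>.\<close>
  obtain \<rho> where \<rho>: "\<rho> \<in> hom F F"
      "\<And>s. s \<in> S \<Longrightarrow> \<rho> s = (if s = a then e1 else if s = b then e2 else \<one>)"
    using endomorphism_exists[of "\<lambda>s. if s = a then e1 else if s = b then e2 else \<one>"] e1 e2 by auto
  obtain \<rho>' where \<rho>': "\<rho>' \<in> hom F F"
      "\<And>s. s \<in> S \<Longrightarrow> \<rho>' s = (if s = a then a [^] n else if s = b then z2 else \<one>)"
    using endomorphism_exists[of "\<lambda>s. if s = a then a [^] n else if s = b then z2 else \<one>"] an z2 ac by auto
  have \<rho>_M: "\<rho> h \<in> M" "\<rho> h \<in> ?K" "\<rho>' h \<in> M" if "h \<in> carrier F" for h
    using that generate_S e1 e2 e2K z2 an \<rho> \<rho>' K M_subgroup S_carrier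
      hom_generate_in_subgroup[OF \<rho>(1) is_group S_carrier M_subgroup, of h]
      hom_generate_in_subgroup[OF \<rho>(1) is_group S_carrier K, of h]
      hom_generate_in_subgroup[OF \<rho>'(1) is_group S_carrier M_subgroup, of h]
    by (auto simp: subgroup.one_closed)
  have "\<exists>\<theta> \<kappa>. range \<theta> \<subseteq> ?K \<and>
      (\<forall>j. \<forall>v \<in> carrier F. \<kappa> j v \<in> carrier F) \<and>
      (\<forall>j. \<kappa> j \<one> = \<one>) \<and>
      (\<forall>j. \<forall>v \<in> carrier F. \<kappa> j (\<theta> x \<otimes> v) = wrap n (j + 1) F \<alpha> \<otimes> \<kappa> (j + 1) v) \<and>
      (\<forall>j. \<forall>y < l. \<forall>v \<in> carrier F. y \<noteq> x \<longrightarrow> \<kappa> j (\<theta> y \<otimes> v) = d y (j mod n) \<otimes> \<kappa> j v) \<and>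
      (\<forall>j. \<forall>v \<in> B. \<kappa> j v \<in> B) \<and>
      (\<forall>w. word_value F \<theta> w \<in> B \<longrightarrow> n dvd exponent_sum x w)"
    if \<alpha>: "\<alpha> \<in> ?K" and d: "\<forall>y i. d y i \<in> ?K" for x l :: nat and \<alpha> d
  proof -
    have \<alpha>c: "\<alpha> \<in> carrier F" using \<alpha> KF by blast
    obtain \<kappa>1 where c1: "\<forall>j. \<forall>v \<in> carrier F. \<kappa>1 j v \<in> carrier F"
      and M1: "\<forall>j. \<forall>y \<in> M. \<forall>v \<in> carrier F. \<kappa>1 j (y \<otimes> v) = \<kappa>1 j y \<otimes> \<kappa>1 j v"
      and s1: "\<forall>j e. \<forall>v \<in> carrier F. \<kappa>1 j (a [^] (e :: int) \<otimes> v) = \<kappa>1 j (a [^] e) \<otimes> \<kappa>1 (j + e) v"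
      and a1: "\<forall>j. \<kappa>1 j a = wrap n (j + 1) F m"
      and m1: "\<forall>j. \<kappa>1 j m = (if j mod n = 0 then a else \<one>)"
      and B1: "\<forall>j. \<forall>v \<in> B. \<kappa>1 j v \<in> B"
      by (rule independentE[OF ind mc, of "\<lambda>i. if i = 0 then a else \<one>"]) (simp add: ac, rule that)
    \<comment> \<open>Coordinates 0 and 1 of \<open>m\<close> are chosen so that \<open>m\<close>
      yields \<open>\<alpha>\<close> while \<open>z2\<close> yields
      \<open>\<alpha> \<otimes> inv (inv b \<otimes> \<alpha>) = b\<close>. They are distinct
      because \<open>n \<ge> 2\<close>.\<close>
    obtain \<kappa>2 where c2: "\<forall>j. \<forall>v \<in> carrier F. \<kappa>2 j v \<in> carrier F"
      and M2: "\<forall>j. \<forall>y \<in> M. \<forall>v \<in> carrier F. \<kappa>2 j (y \<otimes> v) = \<kappa>2 j y \<otimes> \<kappa>2 j v"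
      and s2: "\<forall>j e. \<forall>v \<in> carrier F. \<kappa>2 j (a [^] (e :: int) \<otimes> v) = \<kappa>2 j (a [^] e) \<otimes> \<kappa>2 (j + e) v"
      and a2: "\<forall>j. \<kappa>2 j a = wrap n (j + 1) F a"
      and m2: "\<forall>j. \<kappa>2 j m = (if j mod n = 0 then \<alpha> else if j mod n = 1 then inv b \<otimes> \<alpha> else \<one>)"
      and B2: "\<forall>j. \<forall>v \<in> B. \<kappa>2 j v \<in> B"
      by (rule independentE[OF ind ac, of "\<lambda>i. if i = 0 then \<alpha> else if i = 1 then inv b \<otimes> \<alpha> else \<one>"])
        (simp add: bc \<alpha>c, rule that)
    have hom: "\<kappa> j \<in> hom (F\<lparr>carrier := M\<rparr>) F"
      if "\<forall>j. \<forall>v \<in> carrier F. \<kappa> j v \<in> carrier F"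
        "\<forall>j. \<forall>y \<in> M. \<forall>v \<in> carrier F. \<kappa> j (y \<otimes> v) = \<kappa> j y \<otimes> \<kappa> j v" for \<kappa> :: "int \<Rightarrow> 'a \<Rightarrow> 'a" and j
      using that by (intro homI) auto
    interpret h1: group_hom "F\<lparr>carrier := M\<rparr>" F "\<kappa>1 j" for j
      using hom[OF c1 M1] by (intro group_hom.intro group_hom_axioms.intro subgroup_imp_group M_subgroup is_group)
    interpret h2: group_hom "F\<lparr>carrier := M\<rparr>" F "\<kappa>2 j" for j
      using hom[OF c2 M2] by (intro group_hom.intro group_hom_axioms.intro subgroup_imp_group M_subgroup is_group)
    have one: "\<kappa>1 j \<one> = \<one>" "\<kappa>2 j \<one> = \<one>" for j using h1.hom_one h2.hom_one by simp_all
    have inv1: "\<kappa>1 j (inv y) = inv (\<kappa>1 j y)" if "y \<in> M" for j y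
      using h1.hom_inv[of y j] that M_subgroup by (simp add: m_inv_consistent)
    have inv2: "\<kappa>2 j (inv y) = inv (\<kappa>2 j y)" if "y \<in> M" for j y
      using h2.hom_inv[of y j] that M_subgroup by (simp add: m_inv_consistent)
    \<comment> \<open>From a multiple of \<open>n\<close>, fewer than \<open>n\<close> forward steps
      never take the wrap-around edge; the next fact adds the one step that does.\<close>
    have pow_one: "\<kappa> j (a [^] int t) = \<one>"
      if "\<forall>j. \<kappa> j \<one> = \<one>" "\<forall>j. \<kappa> j a = wrap n (j + 1) F \<gamma>"
        "\<forall>j e. \<forall>v \<in> carrier F. \<kappa> j (a [^] (e :: int) \<otimes> v) = \<kappa> j (a [^] e) \<otimes> \<kappa> (j + e) v"
        "j mod n = 0" "int t < n" for \<kappa> :: "int \<Rightarrow> 'a \<Rightarrow> 'a" and \<gamma> j t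
      using that(5)
    proof (induction t)
      case (Suc t)
      have "\<not> n dvd j + int t + 1"
      proof
        assume "n dvd j + int t + 1"
        then have "n dvd int (Suc t)" using that(4)
          by (metis add.assoc dvd_add_right_iff dvd_eq_mod_eq_0 of_nat_Suc add.commute)
        then show False using Suc.prems by (simp add: zdvd_not_zless)
      qed
      then have "\<kappa> (j + int t) a = \<one>" using that(2) by (simp add: wrap_def)
      moreover have "a [^] int (Suc t) = a [^] int t \<otimes> a"
        using int_pow_mult[OF ac, of "int t" 1] ac by (simp add: add.commute)
      ultimately show ?case using Suc that(3) ac by simp
    qed (use that in simp)
    have pow_n: "\<kappa> j (a [^] n) = \<gamma>"
      if "\<forall>j. \<kappa> j \<one> = \<one>" "\<forall>j. \<kappa> j a = wrap n (j + 1) F \<gamma>"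
        "\<forall>j e. \<forall>v \<in> carrier F. \<kappa> j (a [^] (e :: int) \<otimes> v) = \<kappa> j (a [^] e) \<otimes> \<kappa> (j + e) v"
        "j mod n = 0" "\<gamma> \<in> carrier F" for \<kappa> :: "int \<Rightarrow> 'a \<Rightarrow> 'a" and \<gamma> j
    proof -
      have "a [^] n = a [^] (n - 1) \<otimes> a" using int_pow_mult[OF ac, of "n - 1" 1] ac by simp
      moreover have "\<kappa> j (a [^] (n - 1)) = \<one>"
        using pow_one[OF that(1-4), of "nat (n - 1)"] n by simp
      moreover have "\<kappa> (j + (n - 1)) a = \<gamma>" using that n by (simp add: wrap_def dvd_eq_mod_eq_0)
      ultimately show ?thesis using that ac by simp
    qed
    have e1_val: "\<kappa>1 j e1 = (if j mod n = 0 then a [^] n else \<one>)" for j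
    proof -
      have "\<kappa>1 j (m [^]\<^bsub>F\<lparr>carrier := M\<rparr>\<^esub> n) = \<kappa>1 j m [^] n" using m by (intro h1.hom_int_pow) simp
      moreover have "m [^]\<^bsub>F\<lparr>carrier := M\<rparr>\<^esub> n = m [^] n" using m M_subgroup by (metis int_pow_consistent)
      ultimately show ?thesis unfolding e1_def using m1 by (simp add: int_pow_one)
    qed
    have e2_val: "\<kappa>1 j e2 = (if j mod n = 0 then z2 else \<one>)" for j
    proof -
      have "\<kappa>1 j e2 = \<kappa>1 j (a [^] n) \<otimes> \<kappa>1 j m \<otimes> inv (\<kappa>1 j (a [^] n)) \<otimes> inv (\<kappa>1 j m)"
        unfolding e2_def using M1 an m mc c1 by (simp add: inv1 m_assoc)
      moreover have "\<kappa>1 j (a [^] n) = m" if "j mod n = 0"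
        using pow_n[of \<kappa>1 m j] one a1 s1 that mc by blast
      ultimately show ?thesis
        using m1 c1 ac mc by (simp add: z2_def m_assoc)
    qed
    have \<rho>_val: "\<kappa>1 j (\<rho> h) = (if j mod n = 0 then \<rho>' h else \<one>)" if "h \<in> ?K" for j h
    proof -
      have hom1: "\<kappa>1 j \<circ> \<rho> \<in> hom F F"
        using \<rho>(1) \<rho>_M c1 M1 by (intro homI) (auto simp: hom_mult)
      have "(\<kappa>1 j \<circ> \<rho>) h = (if j mod n = 0 then \<rho>' else (\<lambda>_. \<one>)) h"
        using \<rho>(2) \<rho>'(2) a b e1_val e2_val \<rho>'(1) ac bc
        by (intro hom_eq_on_generate[OF hom1 _ is_group _ _ that]) (auto intro: homI)
      then show ?thesis by simp
    qed
    have z2_val: "\<kappa>2 0 z2 = b"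
    proof -
      have "\<kappa>2 0 (a \<otimes> inv m \<otimes> inv a) = inv (inv b \<otimes> \<alpha>)"
      proof -
        have w: "wrap n 1 F a = \<one>" using n(1) by (simp add: wrap_def)
        have s: "\<kappa>2 j (a \<otimes> v) = \<kappa>2 j a \<otimes> \<kappa>2 (j + 1) v" if "v \<in> carrier F" for j v
          using s2[rule_format, of v j 1] that ac by simp
        have "\<kappa>2 0 (a \<otimes> inv m \<otimes> inv a) = \<kappa>2 1 (inv m \<otimes> inv a)"
          using s[of "inv m \<otimes> inv a" 0] a2 w mc ac c2 by (simp add: m_assoc)
        also have "\<dots> = inv (\<kappa>2 1 m) \<otimes> \<kappa>2 1 (inv a)"
          using M2 m ac by (simp add: inv2)
        also have "\<kappa>2 1 (inv a) = \<one>"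
          using s[of "inv a" 0] a2 w ac c2 one by simp
        also have "\<kappa>2 1 m = inv b \<otimes> \<alpha>" using m2 n by simp
        finally show ?thesis using bc \<alpha>c by simp
      qed
      moreover have "\<kappa>2 0 z2 = \<kappa>2 0 m \<otimes> \<kappa>2 0 (a \<otimes> inv m \<otimes> inv a)"
        unfolding z2_def using M2 m ac mc by simp
      ultimately show ?thesis
        using m2 bc \<alpha>c by (simp add: inv_mult_group m_assoc[symmetric])
    qed
    have \<rho>'_val: "\<kappa>2 0 (\<rho>' h) = h" if "h \<in> ?K" for h
    proof -
      have hom2: "\<kappa>2 0 \<circ> \<rho>' \<in> hom F F"
        using \<rho>'(1) \<rho>_M c2 M2 by (intro homI) (auto simp: hom_mult)
      have "\<kappa>2 0 (a [^] n) = a" using pow_n[of \<kappa>2 a 0] one a2 s2 ac by simp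
      then have "(\<kappa>2 0 \<circ> \<rho>') h = (\<lambda>x. x) h"
        using \<rho>'(2) a b z2_val ac bc
        by (intro hom_eq_on_generate[OF hom2 _ is_group _ _ that]) (auto intro: homI)
      then show ?thesis by simp
    qed
    have dc: "d y i \<in> carrier F" for y i using d KF by blast
    have conj_M: "a [^] (- int t) \<otimes> \<rho> (d y i) \<otimes> a [^] int t \<in> M" for t y i
      using M_conj[of "\<rho> (d y i)" "a [^] (- int t)"] \<rho>_M(1)[OF dc] ac by (simp add: int_pow_neg)
    have conj_val: "\<kappa>1 j (a [^] (- int t) \<otimes> \<rho> (d y (int t)) \<otimes> a [^] int t) =
        (if j mod n = int t then \<rho>' (d y (j mod n)) else \<one>)" if t: "int t < n" for j t y
    proof -
      let ?r = "\<rho> (d y (int t))" let ?i = "j - int t"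
      have r: "?r \<in> M" using \<rho>_M(1)[OF dc] .
      have canc: "\<kappa>1 j (a [^] (- int t)) \<otimes> \<kappa>1 ?i (a [^] int t) = \<one>"
        using s1[rule_format, of "a [^] int t" j "- int t"] ac one
        by (simp add: int_pow_mult[symmetric])
      have "\<kappa>1 j (a [^] (- int t) \<otimes> ?r \<otimes> a [^] int t) =
          \<kappa>1 j (a [^] (- int t)) \<otimes> (\<kappa>1 ?i ?r \<otimes> \<kappa>1 ?i (a [^] int t))"
        using s1[rule_format, of "?r \<otimes> a [^] int t" j "- int t"] M1 r ac by (simp add: m_assoc)
      moreover have "j mod n = int t \<longleftrightarrow> ?i mod n = 0"
        using t n by (metis dvd_eq_mod_eq_0 mod_eq_dvd_iff mod_pos_pos_trivial of_nat_0_le_iff)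
      moreover have "\<kappa>1 j (a [^] (- int t)) = \<one>" "\<kappa>1 ?i (a [^] int t) = \<one>" if "?i mod n = 0"
      proof -
        show *: "\<kappa>1 ?i (a [^] int t) = \<one>" using pow_one[of \<kappa>1 m ?i t] one a1 s1 that t by blast
        show "\<kappa>1 j (a [^] (- int t)) = \<one>" using canc * c1 ac by simp
      qed
      ultimately show ?thesis
        using canc \<rho>_val d \<rho>_M(3)[OF dc] c1 ac by (auto simp del: int_pow_int)
    qed
    define \<theta> where "\<theta> y = (if y = x then a else spread a \<rho> (d y) (nat n))" for y
    have spread_M: "spread a \<rho> (d y) t \<in> M" for y t
      by (induction t) (use conj_M in auto)
    have spread_K: "spread a \<rho> (d y) t \<in> ?K" for y t
    proof (induction t)
      case (Suc t)
      have "a [^] e \<in> ?K" for e :: int using aK K by (rule subgroup_int_pow_closed[rotated])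
      then show ?case using Suc \<rho>_M(2)[OF dc] K by (auto intro!: subgroup.m_closed simp del: int_pow_int)
    qed (use K in \<open>simp add: subgroup.one_closed\<close>)
    have spread_val: "\<kappa>1 j (spread a \<rho> (d y) t) = (if j mod n < int t then \<rho>' (d y (j mod n)) else \<one>)"
      if "int t \<le> n" for j y t
      using that
    proof (induction t)
      case 0
      have "\<not> j mod n < 0" using n pos_mod_sign[of n j] by linarith
      then show ?case using one by simp
    next
      case (Suc t)
      have "\<kappa>1 j (spread a \<rho> (d y) (Suc t)) = \<kappa>1 j (spread a \<rho> (d y) t) \<otimes>
          \<kappa>1 j (a [^] (- int t) \<otimes> \<rho> (d y (int t)) \<otimes> a [^] int t)"
        using M1 spread_M conj_M by simp
      then show ?case using Suc conj_val[of t j y] \<rho>_M(3)[OF dc] by auto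
    qed
    define \<kappa> where "\<kappa> j v = \<kappa>2 0 (\<kappa>1 j v)" for j v
    show ?thesis
    proof (intro exI[of _ \<theta>] exI[of _ \<kappa>] conjI allI ballI impI)
      show "range \<theta> \<subseteq> ?K" using aK spread_K by (auto simp: \<theta>_def)
    next
      fix j v assume v: "v \<in> carrier F"
      show "\<kappa> j v \<in> carrier F" unfolding \<kappa>_def using v c1 c2 by blast
      have "\<kappa>1 j (a \<otimes> v) = wrap n (j + 1) F m \<otimes> \<kappa>1 (j + 1) v"
        using s1[rule_format, of v j 1] v a1 ac by simp
      moreover have "\<kappa>2 0 (wrap n (j + 1) F m \<otimes> w) = wrap n (j + 1) F \<alpha> \<otimes> \<kappa>2 0 w" if "w \<in> carrier F" for w
        using M2 m m2 that c2 one by (simp add: wrap_def)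
      ultimately show "\<kappa> j (\<theta> x \<otimes> v) = wrap n (j + 1) F \<alpha> \<otimes> \<kappa> (j + 1) v"
        unfolding \<kappa>_def \<theta>_def using v c1 by simp
    next
      fix j y v assume v: "v \<in> carrier F" and y: "y \<noteq> x"
      have "\<kappa>1 j (\<theta> y \<otimes> v) = \<rho>' (d y (j mod n)) \<otimes> \<kappa>1 j v"
        using M1 spread_M spread_val[of "nat n" j y] v y n by (simp add: \<theta>_def)
      moreover have "\<kappa>2 0 (\<rho>' (d y (j mod n)) \<otimes> w) = d y (j mod n) \<otimes> \<kappa>2 0 w" if "w \<in> carrier F" for w
        using M2 that \<rho>_M(3)[OF dc] \<rho>'_val d by simp
      ultimately show "\<kappa> j (\<theta> y \<otimes> v) = d y (j mod n) \<otimes> \<kappa> j v"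
        unfolding \<kappa>_def using v c1 by simp
    next
      fix w assume "word_value F \<theta> w \<in> B"
      then have "word_value F \<theta> w \<in> M" using B_M by blast
      then show "n dvd exponent_sum x w"
        using normal.word_value_mem_imp_dvd[OF normal, of \<theta> x a n w] n ac spread_M by (simp add: \<theta>_def)
    qed (use one B1 B2 in \<open>simp_all add: \<kappa>_def\<close>)
  qed
  then show ?thesis unfolding collapsing_def using n KF aK by auto
qed

end

subsection \<open>Elements of infinite order modulo \<open>M\<close>\<close>

lemma (in group) word_value_single_letter:
  assumes "a \<in> carrier G"
  shows "fst ` set w \<subseteq> {a} \<Longrightarrow> word_value G (\<lambda>x. x) w = a [^] exponent_sum a w"
proof (induction w)
  case (Cons l w)
  then obtain b where l: "l = (a, b)" by (cases l) auto
  have "a [^] (1 + exponent_sum a w) = a \<otimes> a [^] exponent_sum a w"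
    "a [^] (- 1 + exponent_sum a w) = inv a \<otimes> a [^] exponent_sum a w"
    using int_pow_mult[OF assms, of 1] int_pow_mult[OF assms, of "- 1"] assms by (simp_all add: int_pow_neg)
  then show ?case using Cons l by simp
qed simp

lemma (in group) conj_inv_cancel:
  assumes "x \<in> carrier G" "y \<in> carrier G"
  shows "inv x \<otimes> (x \<otimes> y \<otimes> inv x) \<otimes> x = y"
proof -
  have "inv x \<otimes> (x \<otimes> y \<otimes> inv x) \<otimes> x = (inv x \<otimes> x) \<otimes> y \<otimes> (inv x \<otimes> x)"
    using assms by (simp only: m_assoc m_closed inv_closed)
  then show ?thesis using assms by simp
qed

context free_on
begin

lemma cocycle_word_value:
  assumes "\<And>x s. x \<in> carrier F \<Longrightarrow> s \<in> S \<Longrightarrow> f x s \<in> carrier F" "x \<in> carrier F" "fst ` set w \<subseteq> S"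
  shows "cocycle f x (word_value F (\<lambda>x. x) w) = word_cocycle F f x w"
  unfolding cocycle_def using assms by (simp add: norm_word_value word_cocycle_free_reduce)

text \<open>The factor \<open>if b then \<one> else inv s\<close> passes from the current vertex to
  the initial vertex of the edge, which for an inverse letter is the vertex reached next.\<close>

lemma word_cocycle_trivial:
  assumes "x \<in> carrier F" "fst ` set w \<subseteq> S"
    and "\<And>u s b v. w = u @ (s, b) # v \<Longrightarrow>
      f (x \<otimes> word_value F (\<lambda>x. x) u \<otimes> (if b then \<one> else inv s)) s = \<one>"
  shows "word_cocycle F f x w = \<one>"
  using assms
proof (induction w arbitrary: x)
  case (Cons l w)
  obtain s b where l: "l = (s, b)" by fastforce
  let ?g = "if b then s else inv s"
  have s: "s \<in> carrier F" using Cons.prems(2) l by auto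
  have "f (x \<otimes> (if b then \<one> else inv s)) s = \<one>" using Cons.prems(3)[of "[]" s b w] l Cons.prems(1) by simp
  moreover have "word_cocycle F f (x \<otimes> ?g) w = \<one>"
  proof (rule Cons.IH)
    fix u t c v assume w: "w = u @ (t, c) # v"
    have u: "word_value F (\<lambda>x. x) u \<in> carrier F" using Cons.prems(2) w by (intro word_value_S_closed) auto
    show "f (x \<otimes> ?g \<otimes> word_value F (\<lambda>x. x) u \<otimes> (if c then \<one> else inv t)) t = \<one>"
      using Cons.prems(3)[of "l # u" t c v] w l u s Cons.prems(1) by (cases b) (simp_all add: m_assoc)
  qed (use Cons.prems s in auto)
  ultimately show ?case using l Cons.prems(1) by (cases b) simp_all
qed simp

text \<open>Repeating one letter gives a reduced word, so uniqueness of normal forms keeps its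
  positive powers away from \<open>\<one>\<close>.\<close>

lemma basis_int_pow_eq_one:
  assumes "a \<in> S" "a [^] (e :: int) = \<one>"
  shows "e = 0"
proof -
  have *: "k = 0" if "a [^] (k :: nat) = \<one>" for k
  proof -
    have "reduced (replicate k (a, True))" by (induction k) (auto simp: reduced_Cons hd_replicate)
    moreover have "word_value F (\<lambda>x. x) (replicate k (a, True)) = a [^] k"
      using assms(1) by (induction k) (simp_all add: nat_pow_Suc2[symmetric])
    ultimately have "norm_word \<one> = replicate k (a, True)"
      using that assms(1) by (intro norm_word_eqI) auto
    moreover have "norm_word \<one> = []" by (intro norm_word_eqI) auto
    ultimately show ?thesis by simp
  qed
  show ?thesis
  proof (cases "e \<ge> 0")
    case True
    then show ?thesis using *[of "nat e"] assms(2) by (simp add: int_pow_int[symmetric])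
  next
    case False
    have "a [^] (- e) = \<one>" using assms by (simp add: int_pow_neg)
    then show ?thesis using *[of "nat (- e)"] False by (simp add: int_pow_int[symmetric])
  qed
qed

end

context preserved_subset
begin

text \<open>A shortest non-trivial relator \<open>r\<close> of \<open>F / M\<close> traces a simple cycle in the Cayley graph, so
  a label on a single edge of the cycle is met exactly once. Translates of this edge by large powers
  of \<open>a\<close> do not interfere with each other.\<close>

lemma infinite_order_collapsing:
  assumes a: "a \<in> S" and inf: "\<And>e :: int. a [^] e \<in> M \<Longrightarrow> e = 0" and M: "M \<noteq> {\<one>}"
  shows "collapsing B (carrier F) 0"
proof -
  let ?val = "word_value F (\<lambda>x. x)"
  have ac: "a \<in> carrier F" using a by auto
  define P where "P r \<longleftrightarrow> reduced r \<and> r \<noteq> [] \<and> fst ` set r \<subseteq> S \<and> ?val r \<in> M" for r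
  obtain y where y: "y \<in> M" "y \<noteq> \<one>" using M M_one by blast
  then have "norm_word y \<noteq> []" using norm_word(3)[of y] by auto
  then have "P (norm_word y)" unfolding P_def using norm_word[of y] y by auto
  then obtain r where r: "P r" and min: "\<And>t. P t \<Longrightarrow> length r \<le> length t"
    using ex_has_least_nat[of P "norm_word y" length] by blast
  have rr: "reduced r" "r \<noteq> []" "fst ` set r \<subseteq> S" "?val r \<in> M" using r unfolding P_def by auto
  have sub: "fst ` set u \<subseteq> S" if "set u \<subseteq> set r" for u
    using image_mono[OF that, of fst] rr(3) by (rule order_trans)
  \<comment> \<open>A relator in \<open>a\<close> alone would be a power of \<open>a\<close> in
    \<open>M\<close>, hence trivial in \<open>F\<close>, although \<open>r\<close> is reduced and
    non-empty.\<close>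
  have "\<not> fst ` set r \<subseteq> {a}"
  proof
    assume "fst ` set r \<subseteq> {a}"
    then have e: "?val r = a [^] exponent_sum a r" by (rule word_value_single_letter[OF ac])
    then have "?val r = \<one>" using inf[of "exponent_sum a r"] rr(4) by simp
    then have "norm_word \<one> = r" using rr by (intro norm_word_eqI) auto
    moreover have "norm_word \<one> = []" by (intro norm_word_eqI) auto
    ultimately show False using rr by simp
  qed
  then have "\<exists>l \<in> set r. fst l \<noteq> a" by blast
  then obtain b \<epsilon> where b: "(b, \<epsilon>) \<in> set r" "b \<noteq> a" by auto
  then obtain r1 r2 where r12: "r = r1 @ (b, \<epsilon>) # r2" by (meson split_list)
  have bS: "b \<in> S" and bc: "b \<in> carrier F" using b rr(3) by force+
  have prefix_S: "fst ` set u \<subseteq> S" if "u @ t = r" for u t using that by (intro sub) auto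
  have prefix_c: "?val u \<in> carrier F" if "u @ t = r" for u t
    using prefix_S[OF that] by (rule word_value_S_closed)
  have distinct1: "u = [] \<and> t' = []"
    if "u @ t @ t' = r" "t \<noteq> []" "?val t \<in> M" for u t t'
  proof -
    have "fst ` set t \<subseteq> S" using that by (intro sub) auto
    then have "P t" unfolding P_def using that rr reduced_appendD[of u "t @ t'"] reduced_appendD[of t t'] by auto
    then show ?thesis using min[of t] that(1) by auto
  qed
  have val_append: "?val (u @ t) = ?val u \<otimes> ?val t" if "u @ t @ t' = r" for u t t'
  proof -
    have "fst ` set u \<subseteq> S" "fst ` set t \<subseteq> S" using that by (auto intro!: sub)
    then show ?thesis using S_carrier by (intro word_value_append) auto
  qed
  have suffix: "u = [] \<and> t' = [] \<or> t = []"
    if "u @ t @ t' = r" "?val u \<otimes> inv (?val (u @ t)) \<in> M \<or> ?val (u @ t) \<otimes> inv (?val u) \<in> M" for u t t'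
  proof -
    have c: "?val u \<in> carrier F" "?val t \<in> carrier F"
      using that by (auto intro!: word_value_S_closed sub)
    have "?val u \<otimes> ?val t \<otimes> inv (?val u) \<in> M"
      using that(2) M_inv[of "?val u \<otimes> inv (?val (u @ t))"] val_append[OF that(1)] c
      by (auto simp: inv_mult_group m_assoc)
    then have "?val t \<in> M"
      using M_conj'[of "?val u \<otimes> ?val t \<otimes> inv (?val u)" "?val u"] c by (simp only: conj_inv_cancel)
    then show ?thesis using distinct1[OF that(1)] by blast
  qed
  \<comment> \<open>Apart from its two ends, the vertices of the cycle lie in distinct cosets; a
    coincidence would cut out a shorter relator.\<close>
  have distinct: "u = u' \<or> u = [] \<and> u' = r \<or> u = r \<and> u' = []"
    if "u @ t = r" "u' @ t' = r" "?val u \<otimes> inv (?val u') \<in> M" for u t u' t'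
  proof -
    from that(1,2) obtain us where "u = u' @ us \<and> us @ t = t' \<or> u @ us = u' \<and> t = us @ t'"
      by (metis append_eq_append_conv2)
    then show ?thesis
    proof
      assume "u = u' @ us \<and> us @ t = t'"
      then show ?thesis using suffix[of u' us t] that by auto
    next
      assume "u @ us = u' \<and> t = us @ t'"
      then show ?thesis using suffix[of u us t'] that by auto
    qed
  qed
  \<comment> \<open>Here the first and last letters would use the same edge modulo \<open>M\<close>;
    by normality \<open>t\<close> would be a shorter relator.\<close>
  have not_conj: "r \<noteq> (b, True) # t @ [(b, False)]" for t
  proof
    assume t: "r = (b, True) # t @ [(b, False)]"
    have tS: "fst ` set t \<subseteq> S" using t by (intro sub) auto
    then have tc: "?val t \<in> carrier F" by simp
    have "?val r = b \<otimes> ?val t \<otimes> inv b"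
      using t tS S_carrier bc tc word_value_append[of "\<lambda>x. x" t "[(b, False)]"] by (simp add: m_assoc subset_trans)
    then have "?val t \<in> M"
      using M_conj'[OF rr(4) bc] bc tc by (simp only: conj_inv_cancel)
    moreover have "reduced t" "t \<noteq> []"
      using t rr(1) reduced_appendD[of t] by (auto simp: reduced_Cons)
    ultimately have "P t" unfolding P_def using tS by simp
    then show False using min[of t] t by simp
  qed
  \<comment> \<open>Spells a path to the initial vertex of the \<open>b\<close>-edge read after
    \<open>u\<close>, so an inverse letter is included.\<close>
  define pre where "pre u c = (if c then u else u @ [(b, False)])" for u c
  have val_pre: "?val (pre u c) = ?val u \<otimes> (if c then \<one> else inv b)" if "r = u @ (b, c) # v" for u c v
  proof -
    have "fst ` set u \<subseteq> carrier F" using prefix_S[of u "(b, c) # v"] that S_carrier by (simp add: subset_trans)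
    then show ?thesis
      using bc prefix_c[of u "(b, c) # v"] that word_value_append[of "\<lambda>x. x" u "[(b, False)]"]
      by (simp add: pre_def)
  qed
  have pre_prefix: "pre u c @ (if c then (b, c) # v else v) = r" if "r = u @ (b, c) # v" for u c v
    using that by (simp add: pre_def)
  have edge: "u = r1" if s: "r = u @ (b, c) # v" and m: "?val (pre u c) \<otimes> inv (?val (pre r1 \<epsilon>)) \<in> M" for u c v
  proof -
    have no_cancel: "r \<noteq> w @ (b, d) # (b, \<not> d) # w'" for w d w'
      using rr(1) unfolding reduced_def by auto
    consider "pre u c = pre r1 \<epsilon>" | "pre u c = []" "pre r1 \<epsilon> = r" | "pre u c = r" "pre r1 \<epsilon> = []"
      using distinct[OF pre_prefix[OF s] pre_prefix[OF r12] m] by blast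
    then show ?thesis
    proof cases
      case 1
      then show ?thesis
        using no_cancel[of u False v] no_cancel[of u False r2] no_cancel[of r1 False v] no_cancel[of r1 False r2] s r12
        by (cases c; cases \<epsilon>) (auto simp: pre_def)
    next
      case 2
      then have "u = []" "c" "\<not> \<epsilon>" "r2 = []" using r12 by (auto simp: pre_def split: if_splits)
      then show ?thesis using s r12 not_conj by (cases r1) auto
    next
      case 3
      then have "r1 = []" "\<epsilon>" "\<not> c" "v = []" using s by (auto simp: pre_def split: if_splits)
      then show ?thesis using s r12 not_conj by (cases u) auto
    qed
  qed
  define p where "p = ?val (pre r1 \<epsilon>)"
  have pc: "p \<in> carrier F" unfolding p_def using prefix_c[OF pre_prefix[OF r12]] .
  \<comment> \<open>The exponents \<open>e\<close> for which a vertex of the cycle lies in the coset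
    of \<open>a [^] e \<otimes> p\<close>. Infinite order allows at most one per vertex, so some
    \<open>N\<close> exceeds them all, and labels at multiples of \<open>N\<close> do not
    interfere.\<close>
  let ?Z = "{e :: int. \<exists>i \<le> length r. ?val (take i r) \<otimes> inv p \<otimes> a [^] (- e) \<in> M}"
  have take_c: "?val (take i r) \<in> carrier F" for i using prefix_c[of "take i r" "drop i r"] by simp
  have "finite ?Z"
  proof -
    have "e = (THE e. ?val (take i r) \<otimes> inv p \<otimes> a [^] (- e) \<in> M)"
      if e: "?val (take i r) \<otimes> inv p \<otimes> a [^] (- e) \<in> M" for i and e :: int
    proof (rule the_equality[symmetric], rule e)
      fix e' :: int assume e': "?val (take i r) \<otimes> inv p \<otimes> a [^] (- e') \<in> M"
      let ?g = "?val (take i r) \<otimes> inv p"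
      have g: "?g \<in> carrier F" using take_c pc by simp
      have "inv (?g \<otimes> a [^] (- e')) \<otimes> (?g \<otimes> a [^] (- e)) = a [^] (e' - e)"
      proof -
        have "inv (?g \<otimes> a [^] (- e')) \<otimes> (?g \<otimes> a [^] (- e)) = a [^] e' \<otimes> ((inv ?g \<otimes> ?g) \<otimes> a [^] (- e))"
          using g ac by (simp only: inv_mult_group int_pow_neg inv_inv m_assoc m_closed inv_closed int_pow_closed)
        then show ?thesis using g ac by (simp add: int_pow_mult[symmetric])
      qed
      then have "a [^] (e' - e) \<in> M" using M_mult[OF M_inv[OF e'] e] by simp
      then have "e' - e = 0" by (rule inf)
      then show "e' = e" by simp
    qed
    then have "?Z \<subseteq> (\<lambda>i. THE e. ?val (take i r) \<otimes> inv p \<otimes> a [^] (- e) \<in> M) ` {..length r}" by auto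
    then show ?thesis by (rule finite_subset) simp
  qed
  then obtain N' where N': "abs ` ?Z \<subseteq> {..<N'}" using finite_int_iff_bounded by blast
  define N where "N = max N' 1"
  have N: "\<bar>e\<bar> < N" if "e \<in> ?Z" for e
  proof -
    have "\<bar>e\<bar> \<in> {..<N'}" using N' imageI[OF that, of abs] by (rule subsetD)
    then show ?thesis by (simp add: N_def)
  qed
  have N0: "N > 0" by (simp add: N_def)
  have "\<exists>\<theta> \<kappa>. range \<theta> \<subseteq> carrier F \<and>
      (\<forall>j. \<forall>v \<in> carrier F. \<kappa> j v \<in> carrier F) \<and>
      (\<forall>j. \<kappa> j \<one> = \<one>) \<and>
      (\<forall>j. \<forall>v \<in> carrier F. \<kappa> j (\<theta> x \<otimes> v) = wrap 0 (j + 1) F \<alpha> \<otimes> \<kappa> (j + 1) v) \<and>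
      (\<forall>j. \<forall>y < l. \<forall>v \<in> carrier F. y \<noteq> x \<longrightarrow> \<kappa> j (\<theta> y \<otimes> v) = d y (j mod 0) \<otimes> \<kappa> j v) \<and>
      (\<forall>j. \<forall>v \<in> B. \<kappa> j v \<in> B) \<and>
      (\<forall>w. word_value F \<theta> w \<in> B \<longrightarrow> 0 dvd exponent_sum x w)"
    if d: "\<forall>y i. d y i \<in> carrier F" for x l :: nat and \<alpha> d
  proof -
    define L where "L = int (Suc l)"
    have L: "L > 0" "int l < L" by (simp_all add: L_def)
    \<comment> \<open>Interleaving: \<open>d y j\<close> is stored at index
      \<open>L * j + int y\<close>. This is possible because only letters \<open>y < l\<close> are
      treated.\<close>
    define \<mu> where "\<mu> t = d (nat (t mod L)) (t div L)" for t
    have \<mu>: "\<mu> t \<in> carrier F" for t using d by (simp add: \<mu>_def)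
    \<comment> \<open>An inverse letter crosses the labelled edge backwards, so the label is
      inverted beforehand.\<close>
    define \<delta> where "\<delta> k = (if \<epsilon> then \<mu> k else inv (\<mu> k))" for k
    define f where "f x s = (if s = b \<and> (\<exists>k. x \<otimes> inv p \<otimes> a [^] (- (N * k)) \<in> M)
      then \<delta> (SOME k. x \<otimes> inv p \<otimes> a [^] (- (N * k)) \<in> M) else \<one>)" for x s
    have f: "f x s \<in> carrier F" for x s using \<mu> by (simp add: f_def \<delta>_def)
    have f_M: "f (y \<otimes> x) s = f x s" if "x \<in> carrier F" "y \<in> M" for x y s
    proof -
      have "y \<otimes> x \<otimes> inv p \<otimes> a [^] (- (N * k)) \<in> M \<longleftrightarrow> x \<otimes> inv p \<otimes> a [^] (- (N * k)) \<in> M" for k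
        using that pc ac coset_cyclic_shift[of y "x \<otimes> inv p" a "- (N * k)"] by (simp add: m_assoc)
      then show ?thesis by (simp only: f_def)
    qed
    let ?c = "cocycle f"
    have label: "f (a [^] (N * j) \<otimes> ?val u \<otimes> (if c then \<one> else inv s)) s = (if u = r1 then \<delta> j else \<one>)"
      if s: "r = u @ (s, c) # v" for j u s c v
    proof (cases "s = b")
      case False
      then show ?thesis using s r12 by (auto simp: f_def)
    next
      case True
      let ?q = "?val (pre u c)"
      have q: "?q \<in> carrier F" using prefix_c pre_prefix s True by blast
      have "?q = ?val u \<otimes> (if c then \<one> else inv b)" using val_pre s True by blast
      then have x: "a [^] (N * j) \<otimes> ?val u \<otimes> (if c then \<one> else inv s) = a [^] (N * j) \<otimes> ?q"
        using prefix_c[of u "(s, c) # v"] s True ac bc by (simp add: m_assoc)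
      have shift: "a [^] (N * j) \<otimes> ?q \<otimes> inv p \<otimes> a [^] (- (N * k)) \<in> M \<longleftrightarrow>
          ?q \<otimes> inv p \<otimes> a [^] (- (N * (k - j))) \<in> M" for k
      proof -
        let ?x = "a [^] (N * j) \<otimes> ?q \<otimes> inv p \<otimes> a [^] (- (N * k))"
        let ?y = "?q \<otimes> inv p \<otimes> a [^] (- (N * (k - j)))"
        have e: "- (N * (k - j)) = - (N * k) + N * j" by (simp add: algebra_simps)
        have "?y = ?q \<otimes> inv p \<otimes> (a [^] (- (N * k)) \<otimes> a [^] (N * j))"
          unfolding e by (simp only: int_pow_mult[OF ac])
        then have xy: "?x \<otimes> a [^] (N * j) = a [^] (N * j) \<otimes> ?y" using ac q pc by (simp add: m_assoc)
        have xc: "?x \<in> carrier F" "?y \<in> carrier F" using ac q pc by simp_all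
        have "inv (a [^] (N * j)) \<otimes> ?x \<otimes> a [^] (N * j) = ?y"
          using xy xc ac by (metis int_pow_closed inv_closed m_assoc l_inv l_one)
        moreover have "a [^] (N * j) \<otimes> ?y \<otimes> inv (a [^] (N * j)) = ?x"
          using xy[symmetric] xc ac by (simp add: m_assoc)
        ultimately show ?thesis using M_conj M_conj' ac by (metis int_pow_closed)
      qed
      \<comment> \<open>\<open>N * (k - j)\<close> lies in \<open>?Z\<close> and so is smaller than
        \<open>N\<close> in absolute value, which forces \<open>k = j\<close>.\<close>
      have small: "k = j \<and> u = r1" if "?q \<otimes> inv p \<otimes> a [^] (- (N * (k - j))) \<in> M" for k
      proof -
        obtain t where "pre u c @ t = r" using pre_prefix s True by blast
        then have i: "take (length (pre u c)) r = pre u c" "length (pre u c) \<le> length r" by auto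
        then have "N * (k - j) \<in> ?Z" using that by (auto intro!: exI[of _ "length (pre u c)"])
        then have "\<bar>N * (k - j)\<bar> < N" by (rule N)
        then have "\<bar>k - j\<bar> < 1" using N0 by (simp add: abs_mult)
        then have "k = j" by simp
        then have "?q \<otimes> inv p \<in> M" using that q pc by simp
        then show ?thesis using \<open>k = j\<close> edge[of u c v] s True unfolding p_def by simp
      qed
      show ?thesis
      proof (cases "u = r1")
        case u: True
        then have "c = \<epsilon>" using s r12 by simp
        then have "?q = p" using u by (simp add: p_def)
        then have ex: "a [^] (N * j) \<otimes> ?q \<otimes> inv p \<otimes> a [^] (- (N * j)) \<in> M"
          using shift[of j] pc by simp
        then have "(SOME k. a [^] (N * j) \<otimes> ?q \<otimes> inv p \<otimes> a [^] (- (N * k)) \<in> M) = j"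
          by (rule some_equality) (use shift small in blast)
        then show ?thesis using ex u True unfolding f_def x by auto
      next
        case u: False
        then show ?thesis using shift small unfolding f_def x by auto
      qed
    qed
    have c_r: "?c (a [^] (N * j)) (?val r) = \<mu> j" for j
    proof -
      let ?x = "a [^] (N * j)"
      let ?g = "if \<epsilon> then b else inv b"
      have x: "?x \<in> carrier F" using ac by simp
      have r1S: "fst ` set r1 \<subseteq> S" "fst ` set r2 \<subseteq> S" using r12 by (auto intro!: sub)
      have r1c: "?val r1 \<in> carrier F" using r1S by simp
      have 1: "word_cocycle F f ?x r1 = \<one>"
      proof (rule word_cocycle_trivial[OF x r1S(1)])
        fix u s c v assume u: "r1 = u @ (s, c) # v"
        then have "u \<noteq> r1" by auto
        then show "f (?x \<otimes> ?val u \<otimes> (if c then \<one> else inv s)) s = \<one>"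
          using label[of u s c "v @ (b, \<epsilon>) # r2" j] u r12 by simp
      qed
      have 2: "word_cocycle F f (?x \<otimes> ?val r1 \<otimes> ?g) r2 = \<one>"
      proof (rule word_cocycle_trivial[OF _ r1S(2)])
        show "?x \<otimes> ?val r1 \<otimes> ?g \<in> carrier F" using x r1c bc by simp
        fix u s c v assume u: "r2 = u @ (s, c) # v"
        let ?u = "r1 @ (b, \<epsilon>) # u"
        have uc: "?val u \<in> carrier F" using u r1S by (intro word_value_S_closed) auto
        have "?val ?u = ?val r1 \<otimes> (?g \<otimes> ?val u)"
          using r1S u bS S_carrier by (subst word_value_append) auto
        then have "?x \<otimes> ?val ?u = ?x \<otimes> ?val r1 \<otimes> ?g \<otimes> ?val u"
          using x r1c uc bc by (simp add: m_assoc)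
        then show "f (?x \<otimes> ?val r1 \<otimes> ?g \<otimes> ?val u \<otimes> (if c then \<one> else inv s)) s = \<one>"
          using label[of ?u s c v j] u r12 by simp
      qed
      have 3: "f (?x \<otimes> ?val r1 \<otimes> (if \<epsilon> then \<one> else inv b)) b = \<delta> j"
        using label[OF r12, of j] by simp
      have "?c ?x (?val r) = word_cocycle F f ?x (r1 @ (b, \<epsilon>) # r2)"
        using cocycle_word_value[of f ?x r] f x rr(3) r12 by simp
      also have "\<dots> = word_cocycle F f ?x r1 \<otimes> word_cocycle F f (?x \<otimes> ?val r1) ((b, \<epsilon>) # r2)"
        using r1S bS x f by (intro word_cocycle_append) auto
      also have "\<dots> = \<mu> j" using 1 2 3 x r1c \<mu> by (cases \<epsilon>) (simp_all add: \<delta>_def)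
      finally show ?thesis .
    qed
    have c_a: "?c x (a [^] e) = \<one>" if "x \<in> carrier F" for x and e :: int
    proof -
      have nat: "?c x (a [^] (k :: nat)) = \<one>" if "x \<in> carrier F" for x k
      proof (induction k)
        case (Suc k)
        have "f y a = \<one>" for y using b by (simp add: f_def)
        then show ?case using Suc that ac a f by (simp add: cocycle_mult cocycle_basis)
      qed (use that f in \<open>simp add: cocycle_one\<close>)
      show ?thesis
      proof (cases "e \<ge> 0")
        case True
        then show ?thesis using nat[OF that, of "nat e"] by (simp add: int_pow_int[symmetric])
      next
        case False
        have "a [^] e = inv (a [^] nat (- e))"
          using False int_pow_neg_int[OF ac, of "nat (- e)"] by simp
        then show ?thesis using that ac f nat by (simp add: cocycle_inv)
      qed
    qed
    have c_a_mult: "?c x (a [^] e \<otimes> v) = ?c (x \<otimes> a [^] e) v"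
      if "x \<in> carrier F" "v \<in> carrier F" for x v and e :: int
      using that ac f c_a cocycle_closed[of f "x \<otimes> a [^] e" v] by (simp add: cocycle_mult)
    have rc: "?val r \<in> carrier F" using rr by simp
    \<comment> \<open>From the vertex of index \<open>L * j\<close>, the value of \<open>y\<close>
      walks along unlabelled \<open>a\<close>-edges to index \<open>L * j + int y\<close>, goes once
      around the cycle and walks back. The value of \<open>x\<close> moves on to the block of
      \<open>j + 1\<close>.\<close>
    define \<theta> where "\<theta> y = (if y = x then a [^] (N * L)
      else a [^] (N * int y) \<otimes> ?val r \<otimes> a [^] (- (N * int y)))" for y
    define \<kappa> where "\<kappa> j v = ?c (a [^] (N * (L * j))) v" for j v
    have \<theta>_M: "\<theta> y \<in> M" if "y \<noteq> x" for y
      using M_conj[OF rr(4), of "a [^] (N * int y)"] ac that by (simp add: \<theta>_def int_pow_neg)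
    show ?thesis
    proof (intro exI[of _ \<theta>] exI[of _ \<kappa>] conjI allI ballI impI)
      show "range \<theta> \<subseteq> carrier F" using ac rc by (auto simp: \<theta>_def)
    next
      fix j v assume v: "v \<in> carrier F"
      show "\<kappa> j v \<in> carrier F" unfolding \<kappa>_def using v ac f by (intro cocycle_closed) auto
      have "a [^] (N * (L * j)) \<otimes> a [^] (N * L) = a [^] (N * (L * (j + 1)))"
        using ac by (simp add: int_pow_mult[symmetric] distrib_left)
      moreover have "?c (a [^] (N * (L * (j + 1)))) v \<in> carrier F" using v ac f by (intro cocycle_closed) auto
      ultimately show "\<kappa> j (\<theta> x \<otimes> v) = wrap 0 (j + 1) F \<alpha> \<otimes> \<kappa> (j + 1) v"
        unfolding \<kappa>_def \<theta>_def using v ac c_a_mult[of "a [^] (N * (L * j))" v "N * L"] by (simp add: wrap_def)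
    next
      fix j y v assume v: "v \<in> carrier F" and y: "y < l" "y \<noteq> x"
      let ?t = "L * j + int y"
      have t: "a [^] (N * (L * j)) \<otimes> a [^] (N * int y) = a [^] (N * ?t)"
        "a [^] (N * ?t) \<otimes> a [^] (- (N * int y)) = a [^] (N * (L * j))"
        using ac by (simp_all add: int_pow_mult[symmetric] distrib_left)
      have \<mu>t: "\<mu> ?t = d y j" unfolding \<mu>_def using y L by simp
      have "\<kappa> j (\<theta> y \<otimes> v) = ?c (a [^] (N * (L * j))) (a [^] (N * int y) \<otimes> (?val r \<otimes> (a [^] (- (N * int y)) \<otimes> v)))"
        unfolding \<kappa>_def \<theta>_def using v y rc ac by (simp add: m_assoc)
      also have "\<dots> = ?c (a [^] (N * ?t)) (?val r \<otimes> (a [^] (- (N * int y)) \<otimes> v))"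
        using v rc ac t by (subst c_a_mult) auto
      also have "\<dots> = ?c (a [^] (N * ?t)) (?val r) \<otimes> ?c (a [^] (N * ?t)) (a [^] (- (N * int y)) \<otimes> v)"
        using rr(4) ac v f f_M by (intro cocycle_M_mult) auto
      also have "\<dots> = d y j \<otimes> \<kappa> j v"
        using c_r[of ?t] \<mu>t c_a_mult[of "a [^] (N * ?t)" v "- (N * int y)"] ac v t by (simp add: \<kappa>_def)
      finally show "\<kappa> j (\<theta> y \<otimes> v) = d y (j mod 0) \<otimes> \<kappa> j v" by simp
    next
      fix w assume "word_value F \<theta> w \<in> B"
      then have w: "word_value F \<theta> w \<in> M" using B_M by blast
      have "0 dvd e" if "(a [^] (N * L)) [^] e \<in> M" for e :: int
        using that inf[of "N * L * e"] ac N0 L by (simp add: int_pow_pow)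
      then show "0 dvd exponent_sum x w"
        using normal.word_value_mem_imp_dvd[OF normal, of \<theta> x "a [^] (N * L)" 0 w] w ac \<theta>_M
        by (simp add: \<theta>_def)
    next
      fix j
      show "\<kappa> j \<one> = \<one>" unfolding \<kappa>_def using ac f by (simp add: cocycle_one)
      show "\<kappa> j v \<in> B" if "v \<in> B" for v
        unfolding \<kappa>_def using that ac f f_M by (intro cocycle_B) auto
    qed
  qed
  then show ?thesis unfolding collapsing_def using ac by auto
qed

end

section \<open>Existence of a collapsing pair in every case\<close>

text \<open>The role of \<open>M\<close> is taken by the kernel of the endomorphism that fixes
  \<open>a\<close> and kills the other basis elements: \<open>a\<close> has infinite order modulo
  it, and it contains \<open>b\<close>. A trivial \<open>B\<close> is preserved by every
  homomorphism.\<close>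

lemma (in free_on) trivial_collapsing:
  assumes a: "a \<in> S" and b: "b \<in> S" "b \<noteq> a" and B: "B \<subseteq> {\<one>}"
  shows "collapsing B (carrier F) 0"
proof -
  obtain \<phi> where \<phi>: "\<phi> \<in> hom F F" "\<And>s. s \<in> S \<Longrightarrow> \<phi> s = (if s = a then a else \<one>)"
    by (rule endomorphism_exists[of "\<lambda>s. if s = a then a else \<one>"]) (use a in auto)
  interpret \<phi>: group_hom F F \<phi>
    using \<phi>(1) by (intro group_hom.intro group_hom_axioms.intro is_group)
  let ?M = "kernel F F \<phi>"
  have mem: "x \<in> ?M \<longleftrightarrow> x \<in> carrier F \<and> \<phi> x = \<one>" for x by (simp add: kernel_def)
  interpret M: preserved_subset F S ?M B
  proof (intro preserved_subset.intro preserved_subset_axioms.intro free_on_axioms)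
    show "?M \<lhd> F" by (rule \<phi>.normal_kernel)
    show "B \<subseteq> ?M" using B by (auto simp: kernel_def)
    fix h assume h: "h \<in> hom (F\<lparr>carrier := ?M\<rparr>) F"
    have "h \<one> = \<one>"
      using hom_one[OF h] subgroup_imp_group[OF \<phi>.subgroup_kernel] is_group by simp
    moreover have "B = {} \<or> B = {\<one>}" using B by (simp add: subset_singleton_iff)
    ultimately show "h ` B \<subseteq> B" by auto
  qed
  show ?thesis
  proof (rule M.infinite_order_collapsing[OF a(1)])
    fix e :: int assume "a [^] e \<in> ?M"
    then have "\<phi> (a [^] e) = \<one>" unfolding mem by blast
    moreover have "\<phi> (a [^] e) = \<phi> a [^] e" using a by (intro \<phi>.hom_int_pow) simp
    moreover have "\<phi> a = a" using a \<phi>(2) by simp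
    ultimately have "a [^] e = \<one>" by simp
    then show "e = 0" using a by (rule basis_int_pow_eq_one[rotated])
  next
    have "b \<in> ?M" unfolding mem using b \<phi>(2) by simp
    moreover have "b \<noteq> \<one>" using basis_int_pow_eq_one[OF b(1), of 1] b by auto
    ultimately show "?M \<noteq> {\<one>}" by blast
  qed
qed

context preserved_subset
begin

text \<open>If no basis element has infinite order modulo \<open>M\<close>, then \<open>a\<close>
  and \<open>b\<close> have finite order, and \<open>a \<notin> M\<close> excludes order 1 for
  \<open>a\<close>.\<close>

lemma exists_collapsing:
  assumes a: "a \<in> S" "a \<notin> M" and b: "b \<in> S" "b \<noteq> a"
  shows "\<exists>K n. collapsing B K n"
proof (cases "M = {\<one>}")
  case True
  then show ?thesis using trivial_collapsing[OF a(1) b] B_M by blast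
next
  case False
  show ?thesis
  proof (cases "\<exists>s \<in> S. \<forall>e :: int. s [^] e \<in> M \<longrightarrow> e = 0")
    case True
    then show ?thesis using infinite_order_collapsing False by blast
  next
    case fin: False
    obtain n where n: "n \<ge> 0" "\<And>e :: int. a [^] e \<in> M \<longleftrightarrow> n dvd e"
      by (rule int_pow_mem_subgroup[OF M_subgroup, of a]) (use a in simp, rule that)
    have "n \<noteq> 0"
    proof -
      obtain e :: int where "a [^] e \<in> M" "e \<noteq> 0" using fin a(1) by blast
      then show ?thesis using n(2)[of e] by auto
    qed
    moreover have "n \<noteq> 1" using n(2)[of 1] a by auto
    ultimately have n2: "n \<ge> 2" using n(1) by simp
    obtain l where l: "l \<ge> 0" "\<And>e :: int. b [^] e \<in> M \<longleftrightarrow> l dvd e"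
      by (rule int_pow_mem_subgroup[OF M_subgroup, of b]) (use b in simp, rule that)
    have "l \<noteq> 0"
    proof -
      obtain e :: int where "b [^] e \<in> M" "e \<noteq> 0" using fin b(1) by blast
      then show ?thesis using l(2)[of e] by auto
    qed
    then have l': "nat l > 0" "b [^] nat l \<in> M" using l(1) l(2)[of l] by (simp_all add: int_pow_int[symmetric])
    have ab: "a \<noteq> b" and "n > 0" using b n2 by auto
    then obtain m where "m \<in> M" "m \<in> generate F {a, b}" "independent n a m"
      using independent_pair[OF a(1) b(1) ab _ n(2) l'] by blast
    then have "collapsing B (generate F {a, b}) n"
      by (rule independent_collapsing[OF a(1) b(1) ab n2 n(2)])
    then show ?thesis by blast
  qed
qed

end

subsection \<open>Verbal subgroups and quotients\<close>

lemma carrier_update_self [simp]: "G\<lparr>carrier := carrier G\<rparr> = G"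
  by simp

context group
begin

lemma verbal_subgroup_is_subgroup: "subgroup (verbal_subgroup W G) G"
  unfolding verbal_subgroup_def
  by (intro generate_is_subgroup) (auto intro!: word_value_closed)

lemma word_value_mem_verbal_subgroup:
  "w \<in> W \<Longrightarrow> range f \<subseteq> carrier G \<Longrightarrow> word_value G f w \<in> verbal_subgroup W G"
  unfolding verbal_subgroup_def by (intro generate.incl) blast

lemma verbal_subgroup_least:
  assumes "subgroup K G" "\<And>f w. w \<in> W \<Longrightarrow> range f \<subseteq> carrier G \<Longrightarrow> word_value G f w \<in> K"
  shows "verbal_subgroup W G \<subseteq> K"
  unfolding verbal_subgroup_def using assms by (intro generate_subgroup_incl) auto

end

lemma (in group_hom) image_verbal_subgroup_subset:
  "h ` verbal_subgroup W G \<subseteq> verbal_subgroup W H"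
proof -
  have "subgroup {x \<in> carrier G. h x \<in> verbal_subgroup W H} G"
    using H.verbal_subgroup_is_subgroup
    by (intro G.subgroupI) (auto simp: subgroup.one_closed subgroup.m_closed subgroup.m_inv_closed intro: exI[of _ "\<one>"])
  then have "verbal_subgroup W G \<subseteq> {x \<in> carrier G. h x \<in> verbal_subgroup W H}"
  proof (rule G.verbal_subgroup_least)
    fix f :: "nat \<Rightarrow> 'a" and w assume w: "w \<in> W" and f: "range f \<subseteq> carrier G"
    have "range (h \<circ> f) \<subseteq> carrier H" using f by auto
    then have "word_value H (h \<circ> f) w \<in> verbal_subgroup W H" using w by (rule H.word_value_mem_verbal_subgroup[rotated])
    moreover have "f ` fst ` set w \<subseteq> carrier G" using f by auto
    ultimately show "word_value G f w \<in> {x \<in> carrier G. h x \<in> verbal_subgroup W H}"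
      by (simp add: hom_word_value G.word_value_closed)
  qed
  then show ?thesis by blast
qed

lemma (in group_hom) image_verbal_subgroup:
  assumes "h ` carrier G = carrier H"
  shows "h ` verbal_subgroup W G = verbal_subgroup W H"
proof
  show "verbal_subgroup W H \<subseteq> h ` verbal_subgroup W G"
  proof (rule H.verbal_subgroup_least)
    show "subgroup (h ` verbal_subgroup W G) H"
      using G.verbal_subgroup_is_subgroup by (rule subgroup_img_is_subgroup)
    fix f :: "nat \<Rightarrow> 'c" and w assume w: "w \<in> W" and f: "range f \<subseteq> carrier H"
    define g where "g i = inv_into (carrier G) h (f i)" for i
    have f': "f i \<in> h ` carrier G" for i using f assms by auto
    have g: "g i \<in> carrier G" "h (g i) = f i" for i
      unfolding g_def using f'[of i] by (rule inv_into_into, rule f_inv_into_f)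
    have "h (word_value G g w) = word_value H (h \<circ> g) w" using g by (intro hom_word_value) auto
    also have "h \<circ> g = f" using g by auto
    finally show "word_value H f w \<in> h ` verbal_subgroup W G"
      using G.word_value_mem_verbal_subgroup[of w W g] w g by (metis imageI image_subset_iff)
  qed
qed (rule image_verbal_subgroup_subset)

context group
begin

lemma verbal_subgroup_mono:
  assumes "subgroup K G" "subgroup L G" "K \<subseteq> L"
  shows "verbal_subgroup W (G\<lparr>carrier := K\<rparr>) \<subseteq> verbal_subgroup W (G\<lparr>carrier := L\<rparr>)"
proof -
  have "(\<lambda>x. x) \<in> hom (G\<lparr>carrier := K\<rparr>) (G\<lparr>carrier := L\<rparr>)"
    using assms by (intro homI) auto
  then interpret group_hom "G\<lparr>carrier := K\<rparr>" "G\<lparr>carrier := L\<rparr>" "\<lambda>x. x"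
    using assms by (intro group_hom.intro group_hom_axioms.intro subgroup_imp_group)
  show ?thesis using image_verbal_subgroup_subset[of W] by simp
qed

lemma verbal_subgroup_of_subgroup:
  assumes "subgroup K G"
  shows "subgroup (verbal_subgroup W (G\<lparr>carrier := K\<rparr>)) G" "verbal_subgroup W (G\<lparr>carrier := K\<rparr>) \<subseteq> K"
proof -
  have s: "subgroup (verbal_subgroup W (G\<lparr>carrier := K\<rparr>)) (G\<lparr>carrier := K\<rparr>)"
    using group.verbal_subgroup_is_subgroup[OF subgroup_imp_group[OF assms]] .
  show "subgroup (verbal_subgroup W (G\<lparr>carrier := K\<rparr>)) G" using incl_subgroup[OF assms s] .
  show "verbal_subgroup W (G\<lparr>carrier := K\<rparr>) \<subseteq> K" using subgroup.subset[OF s] by simp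
qed

lemma verbal_subgroup_normal:
  assumes "K \<lhd> G"
  shows "verbal_subgroup W (G\<lparr>carrier := K\<rparr>) \<lhd> G"
  unfolding normal_inv_iff
proof (intro conjI ballI)
  interpret K: normal K G by (rule assms)
  have K: "subgroup K G" by (rule K.subgroup_axioms)
  show "subgroup (verbal_subgroup W (G\<lparr>carrier := K\<rparr>)) G"
    using K by (rule verbal_subgroup_of_subgroup)
  fix x y assume x: "x \<in> carrier G" and y: "y \<in> verbal_subgroup W (G\<lparr>carrier := K\<rparr>)"
  have "(\<lambda>y. x \<otimes> y \<otimes> inv x) \<in> hom (G\<lparr>carrier := K\<rparr>) (G\<lparr>carrier := K\<rparr>)"
  proof (rule homI)
    fix y z assume "y \<in> carrier (G\<lparr>carrier := K\<rparr>)" "z \<in> carrier (G\<lparr>carrier := K\<rparr>)"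
    then have yz: "y \<in> carrier G" "z \<in> carrier G" by auto
    have "x \<otimes> y \<otimes> inv x \<otimes> (x \<otimes> z \<otimes> inv x) = x \<otimes> y \<otimes> (inv x \<otimes> x) \<otimes> z \<otimes> inv x"
      using x yz by (simp only: m_assoc m_closed inv_closed)
    then show "x \<otimes> (y \<otimes>\<^bsub>G\<lparr>carrier := K\<rparr>\<^esub> z) \<otimes> inv x =
        x \<otimes> y \<otimes> inv x \<otimes>\<^bsub>G\<lparr>carrier := K\<rparr>\<^esub> (x \<otimes> z \<otimes> inv x)"
      using x yz by (simp add: m_assoc)
  qed (use x K.inv_op_closed2 in simp)
  then interpret h: group_hom "G\<lparr>carrier := K\<rparr>" "G\<lparr>carrier := K\<rparr>" "\<lambda>y. x \<otimes> y \<otimes> inv x"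
    by (intro group_hom.intro group_hom_axioms.intro subgroup_imp_group K)
  show "x \<otimes> y \<otimes> inv x \<in> verbal_subgroup W (G\<lparr>carrier := K\<rparr>)"
    using h.image_verbal_subgroup_subset[of W] y by blast
qed

lemma in_variety_iff: "in_variety W G \<longleftrightarrow> verbal_subgroup W G = {\<one>}"
proof
  assume "in_variety W G"
  then have "verbal_subgroup W G \<subseteq> {\<one>}"
    by (intro verbal_subgroup_least triv_subgroup) (auto simp: in_variety_def is_law_def)
  then show "verbal_subgroup W G = {\<one>}"
    using subgroup.one_closed[OF verbal_subgroup_is_subgroup] by blast
next
  assume "verbal_subgroup W G = {\<one>}"
  then show "in_variety W G"
    using word_value_mem_verbal_subgroup is_group unfolding in_variety_def is_law_def by blast
qed

end

lemma (in normal) verbal_subgroup_quotient: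
  "verbal_subgroup W (G Mod H) = (\<lambda>x. H #> x) ` verbal_subgroup W G"
proof -
  interpret q: group_hom G "G Mod H" "\<lambda>x. H #> x"
    using r_coset_hom_Mod by (intro group_hom.intro group_hom_axioms.intro factorgroup_is_group is_group)
  show ?thesis by (rule q.image_verbal_subgroup[symmetric]) (simp add: carrier_FactGroup)
qed

lemma (in normal) r_coset_eq_iff_mem: "x \<in> carrier G \<Longrightarrow> H #> x = H \<longleftrightarrow> x \<in> H"
  by (rule iffI) (rule coset_join1[OF _ _ is_subgroup] coset_join2[OF _ is_subgroup]; assumption)+

text \<open>The quotient by the verbal subgroup lies in the variety. If the verbal subgroup is
  everything, the same holds in each quotient, which then lies in the variety only when
  trivial.\<close>

lemma (in group) has_nontrivial_quotient_iff:
  "has_nontrivial_quotient_in W G \<longleftrightarrow> verbal_subgroup W G \<noteq> carrier G"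
proof
  assume "has_nontrivial_quotient_in W G"
  then obtain M where M: "M \<lhd> G" "\<not> trivial_group (G Mod M)" "in_variety W (G Mod M)"
    unfolding has_nontrivial_quotient_in_def by blast
  interpret M: normal M G by (rule M(1))
  interpret Q: group "G Mod M" by (rule M.factorgroup_is_group)
  show "verbal_subgroup W G \<noteq> carrier G"
  proof
    assume "verbal_subgroup W G = carrier G"
    then have "carrier (G Mod M) = verbal_subgroup W (G Mod M)"
      by (simp add: M.verbal_subgroup_quotient carrier_FactGroup)
    then show False using M(2,3) Q.in_variety_iff Q.is_group by (simp add: trivial_group_def)
  qed
next
  assume V: "verbal_subgroup W G \<noteq> carrier G"
  let ?V = "verbal_subgroup W G"
  have N: "?V \<lhd> G" using verbal_subgroup_normal[OF normal_self, of W] by simp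
  interpret V: normal ?V G by (rule N)
  interpret Q: group "G Mod ?V" by (rule V.factorgroup_is_group)
  have "verbal_subgroup W (G Mod ?V) = {?V}"
  proof -
    have "(\<lambda>x. ?V #> x) ` ?V = (\<lambda>_. ?V) ` ?V"
      using V.r_coset_eq_iff_mem V.subset by (intro image_cong) auto
    moreover have "?V \<noteq> {}" using V.one_closed by blast
    ultimately show ?thesis using V.verbal_subgroup_quotient[of W] by (simp add: image_constant_conv)
  qed
  then have "in_variety W (G Mod ?V)" using Q.in_variety_iff by simp
  moreover have "\<not> trivial_group (G Mod ?V)"
  proof
    assume "trivial_group (G Mod ?V)"
    then have "?V #> x = ?V" if "x \<in> carrier G" for x
      using that by (auto simp: trivial_group_def carrier_FactGroup)
    then have "carrier G \<subseteq> ?V" using V.r_coset_eq_iff_mem by blast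
    then show False using V V.subset by blast
  qed
  ultimately show "has_nontrivial_quotient_in W G" unfolding has_nontrivial_quotient_in_def using N by blast
qed

text \<open>The verbal subgroup of the quotient is the image of that of \<open>G\<close>, with
  preimage \<open>H <#> verbal_subgroup W G\<close>.\<close>

lemma (in normal) quotient_has_nontrivial_quotient_iff:
  "has_nontrivial_quotient_in W (G Mod H) \<longleftrightarrow> H <#> verbal_subgroup W G \<noteq> carrier G"
proof -
  interpret Q: group "G Mod H" by (rule factorgroup_is_group)
  let ?V = "verbal_subgroup W G"
  have V: "?V \<subseteq> carrier G" by (rule subgroup.subset[OF verbal_subgroup_is_subgroup])
  have "(\<lambda>x. H #> x) ` ?V = (\<lambda>x. H #> x) ` carrier G \<longleftrightarrow> H <#> ?V = carrier G"
  proof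
    assume eq: "(\<lambda>x. H #> x) ` ?V = (\<lambda>x. H #> x) ` carrier G"
    show "H <#> ?V = carrier G"
    proof
      show "H <#> ?V \<subseteq> carrier G" using set_mult_closed subset V by blast
      show "carrier G \<subseteq> H <#> ?V"
      proof
        fix x assume x: "x \<in> carrier G"
        then obtain v where "v \<in> ?V" "H #> x = H #> v" using eq by blast
        then show "x \<in> H <#> ?V" using rcos_self[OF x is_subgroup] by (auto simp: r_coset_def set_mult_def)
      qed
    qed
  next
    assume eq: "H <#> ?V = carrier G"
    have "H #> x \<in> (\<lambda>x. H #> x) ` ?V" if "x \<in> carrier G" for x
    proof -
      have "x \<in> H <#> ?V" using that eq by simp
      then obtain h v where hv: "h \<in> H" "v \<in> ?V" "x = h \<otimes> v" unfolding set_mult_def by blast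
      then have "x \<in> H #> v" by (auto simp: r_coset_def)
      then have "H #> v = H #> x" using repr_independence hv(2) V is_subgroup by blast
      then show ?thesis using hv by blast
    qed
    then show "(\<lambda>x. H #> x) ` ?V = (\<lambda>x. H #> x) ` carrier G" using V by blast
  qed
  then show ?thesis by (simp add: Q.has_nontrivial_quotient_iff verbal_subgroup_quotient carrier_FactGroup)
qed

text \<open>Replacing each letter by its component in \<open>A\<close> changes a word value only
  within its coset of \<open>K\<close>.\<close>

lemma (in group) verbal_subgroup_set_mult:
  assumes K: "K \<lhd> G" and A: "subgroup A G"
  shows "verbal_subgroup W (G\<lparr>carrier := K <#> A\<rparr>) \<subseteq> K <#> verbal_subgroup W (G\<lparr>carrier := A\<rparr>)"
proof -
  interpret K: normal K G by (rule K)
  interpret q: group_hom G "G Mod K" "\<lambda>x. K #> x"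
    using K.r_coset_hom_Mod by (intro group_hom.intro group_hom_axioms.intro K.factorgroup_is_group is_group)
  let ?V = "verbal_subgroup W (G\<lparr>carrier := A\<rparr>)"
  have KA: "subgroup (K <#> A) G" using K A by (rule mult_norm_subgroup)
  have V: "subgroup ?V G" "?V \<subseteq> A" using verbal_subgroup_of_subgroup[OF A] by auto
  have KV: "subgroup (K <#> ?V) G" using K V(1) by (rule mult_norm_subgroup)
  have sub: "K <#> ?V \<subseteq> K <#> A" using V(2) by (auto simp: set_mult_def)
  have Ac: "A \<subseteq> carrier G" using A by (rule subgroup.subset)
  show ?thesis
  proof (rule group.verbal_subgroup_least[OF subgroup_imp_group[OF KA]])
    show "subgroup (K <#> ?V) (G\<lparr>carrier := K <#> A\<rparr>)"
      using subgroup_incl[OF KV KA sub] .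
    fix f :: "nat \<Rightarrow> 'a" and w assume w: "w \<in> W" and f: "range f \<subseteq> carrier (G\<lparr>carrier := K <#> A\<rparr>)"
    have "f i \<in> K <#> A" for i using f by auto
    then have "\<exists>a \<in> A. \<exists>k \<in> K. f i = k \<otimes> a" for i unfolding set_mult_def by blast
    then obtain g where g: "\<And>i. g i \<in> A" "\<And>i. \<exists>k \<in> K. f i = k \<otimes> g i" by metis
    have fc: "f i \<in> carrier G" for i using f subgroup.subset[OF KA] by auto
    have gc: "g i \<in> carrier G" for i using g Ac by auto
    have "K #> f i = K #> g i" for i
    proof -
      have "f i \<in> K #> g i" using g(2)[of i] by (auto simp: r_coset_def)
      then show ?thesis using repr_independence[of "f i" K "g i"] gc K.is_subgroup by metis
    qed
    then have eq: "(\<lambda>x. K #> x) \<circ> f = (\<lambda>x. K #> x) \<circ> g" by auto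
    have "K #> word_value G f w = word_value (G Mod K) ((\<lambda>x. K #> x) \<circ> f) w"
      using fc by (intro q.hom_word_value) auto
    also have "\<dots> = K #> word_value G g w"
      unfolding eq using gc by (intro q.hom_word_value[symmetric]) auto
    finally have "word_value G f w \<in> K #> word_value G g w"
      using rcos_self[of "word_value G f w" K] word_value_closed[of f w] fc K.is_subgroup by auto
    moreover have "word_value G g w \<in> ?V"
    proof -
      have "word_value (G\<lparr>carrier := A\<rparr>) g w \<in> ?V"
        using w g by (intro group.word_value_mem_verbal_subgroup[OF subgroup_imp_group[OF A]]) auto
      moreover have "g ` fst ` set w \<subseteq> A" using g by auto
      ultimately show ?thesis using word_value_subgroup[OF A, of g w] by simp
    qed
    ultimately have "word_value G f w \<in> K <#> ?V" by (auto simp: r_coset_def set_mult_def)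
    moreover have "f ` fst ` set w \<subseteq> K <#> A" using f by auto
    ultimately show "word_value (G\<lparr>carrier := K <#> A\<rparr>) f w \<in> K <#> ?V"
      using word_value_subgroup[OF KA, of f w] by simp
  qed
qed

lemma (in free_on) cyclic_if_basis_single:
  assumes "S \<subseteq> {x}" "x \<in> carrier F"
  shows "cyclic_group F"
  unfolding cyclic_group
proof (intro bexI[of _ x] equalityI subsetI)
  fix g assume g: "g \<in> carrier F"
  have "fst ` set (norm_word g) \<subseteq> {x}" using norm_word(2)[OF g] assms(1) by (rule order_trans)
  then show "g \<in> range (\<lambda>n :: int. x [^] n)"
    using word_value_single_letter[OF assms(2)] norm_word(3)[OF g] by (metis rangeI)
qed (use assms in auto)

theorem theorem4p2:
  fixes F :: "('a, 'm) monoid_scheme" and N :: "'a set"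
    and W :: "nat gword set" and H :: "('h, 'k) monoid_scheme"
  assumes "free_group F" and "\<not> cyclic_group F"
    and "N \<lhd> F"
    and proper: "group H" "\<not> in_variety W H"
  shows "has_nontrivial_quotient_in W
           (F\<lparr>carrier := verbal_subgroup W F\<rparr> Mod verbal_subgroup W (F\<lparr>carrier := N\<rparr>))
         \<longleftrightarrow> has_nontrivial_quotient_in W (F Mod N)"
proof -
  obtain S where "group F" "free_basis F S" using assms(1) unfolding free_group_def by blast
  then interpret F: free_on F S by (simp add: free_on_def free_on_axioms_def)
  interpret N: normal N F by (rule assms(3))
  define A where "A = verbal_subgroup W F"
  define VN where "VN = verbal_subgroup W (F\<lparr>carrier := N\<rparr>)"
  define VA where "VA = verbal_subgroup W (F\<lparr>carrier := A\<rparr>)"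
  have A: "A \<lhd> F" unfolding A_def using F.verbal_subgroup_normal[OF F.normal_self, of W] by simp
  then have A_sub: "subgroup A F" by (rule normal_imp_subgroup)
  have VN: "VN \<lhd> F" unfolding VN_def by (rule F.verbal_subgroup_normal[OF assms(3)])
  have VA: "VA \<lhd> F" unfolding VA_def by (rule F.verbal_subgroup_normal[OF A])
  have VN_sub: "subgroup VN F" and VA_sub: "subgroup VA F" using VN VA by (simp_all add: normal_imp_subgroup)
  have VN_A: "VN \<subseteq> A"
    unfolding VN_def A_def using F.verbal_subgroup_mono[OF N.is_subgroup F.subgroup_self N.subset, of W] by simp
  have VA_A: "VA \<subseteq> A" unfolding VA_def using F.verbal_subgroup_of_subgroup[OF A_sub] by simp
  have "VN \<lhd> F\<lparr>carrier := A\<rparr>"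
    using F.normal_restrict_supergroup[OF A_sub VN VN_A] .
  then have 1: "has_nontrivial_quotient_in W (F\<lparr>carrier := A\<rparr> Mod VN) \<longleftrightarrow> VN <#>\<^bsub>F\<^esub> VA \<noteq> A"
    using normal.quotient_has_nontrivial_quotient_iff[of VN "F\<lparr>carrier := A\<rparr>" W]
    by (simp add: VA_def set_mult_def)
  have 2: "has_nontrivial_quotient_in W (F Mod N) \<longleftrightarrow> N <#>\<^bsub>F\<^esub> A \<noteq> carrier F"
    using N.quotient_has_nontrivial_quotient_iff[of W] by (simp add: A_def)
  define M where "M = N <#>\<^bsub>F\<^esub> A"
  have M: "M \<lhd> F" unfolding M_def using assms(3) A by (rule F.normal_subgroup_set_mult_closed)
  then have M_sub: "subgroup M F" by (rule normal_imp_subgroup)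
  have N_M: "N \<subseteq> M"
  proof
    fix x assume x: "x \<in> N"
    then have "x \<otimes>\<^bsub>F\<^esub> \<one>\<^bsub>F\<^esub> \<in> M"
      unfolding M_def set_mult_def using subgroup.one_closed[OF A_sub] by blast
    then show "x \<in> M" using x by simp
  qed
  have A_M: "A \<subseteq> M"
  proof
    fix x assume x: "x \<in> A"
    then have "\<one>\<^bsub>F\<^esub> \<otimes>\<^bsub>F\<^esub> x \<in> M"
      unfolding M_def set_mult_def using N.one_closed by blast
    then show "x \<in> M" using x subgroup.mem_carrier[OF A_sub] by simp
  qed
  have "VN <#>\<^bsub>F\<^esub> VA = A \<longleftrightarrow> M = carrier F"
  proof
    assume M_F: "M = carrier F"
    \<comment> \<open>Since \<open>M\<close> is all of \<open>F\<close>, the verbal subgroup of the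
      product \<open>N A\<close> is \<open>A\<close> itself.\<close>
    have "A \<subseteq> N <#>\<^bsub>F\<^esub> VA"
      using F.verbal_subgroup_set_mult[OF assms(3) A_sub, of W]
      unfolding M_def[symmetric] M_F carrier_update_self VA_def[symmetric] A_def[symmetric] .
    then have "N <#>\<^bsub>F\<^esub> A \<subseteq> N <#>\<^bsub>F\<^esub> (N <#>\<^bsub>F\<^esub> VA)" by (rule mono_set_mult[OF subset_refl])
    also have "\<dots> = (N <#>\<^bsub>F\<^esub> N) <#>\<^bsub>F\<^esub> VA"
      using F.set_mult_assoc[of N N VA] N.subset subgroup.subset[OF VA_sub] by simp
    also have "N <#>\<^bsub>F\<^esub> N = N" using F.subgroup_mult_id[OF N.is_subgroup] by simp
    also have "N <#>\<^bsub>F\<^esub> VA = VA <#>\<^bsub>F\<^esub> N"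
      using F.commut_normal[OF VA_sub assms(3)] by simp
    finally have "VA <#>\<^bsub>F\<^esub> N = carrier F"
      using M_F F.set_mult_closed[of VA N] N.subset subgroup.subset[OF VA_sub] by (auto simp: M_def)
    \<comment> \<open>The same inclusion with \<open>VA\<close> as the normal factor and
      \<open>N\<close> as the one in which words are evaluated.\<close>
    then have "A \<subseteq> VA <#>\<^bsub>F\<^esub> VN"
      using F.verbal_subgroup_set_mult[OF VA N.is_subgroup, of W]
      by (simp only: carrier_update_self VN_def[symmetric] A_def[symmetric])
    also have "\<dots> = VN <#>\<^bsub>F\<^esub> VA" using F.commut_normal[OF VA_sub VN] by simp
    finally have "A \<subseteq> VN <#>\<^bsub>F\<^esub> VA" .
    moreover have "VN <#>\<^bsub>F\<^esub> VA \<subseteq> A"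
      using mono_set_mult[OF VN_A VA_A, of F] F.subgroup_mult_id[OF A_sub] by simp
    ultimately show "VN <#>\<^bsub>F\<^esub> VA = A" by blast
  next
    assume eq: "VN <#>\<^bsub>F\<^esub> VA = A"
    show "M = carrier F"
    proof (rule ccontr)
      assume "M \<noteq> carrier F"
      then have "\<not> carrier F \<subseteq> M" using subgroup.subset[OF M_sub] by blast
      \<comment> \<open>A proper subgroup misses some basis element, and since \<open>F\<close> is
        not cyclic there is a second one.\<close>
      then have "\<not> S \<subseteq> M" using F.generate_S F.generate_subgroup_incl[OF _ M_sub] by metis
      then obtain a where a: "a \<in> S" "a \<notin> M" by blast
      have "\<not> S \<subseteq> {a}" using F.cyclic_if_basis_single[of a] assms(2) a by auto
      then obtain b where b: "b \<in> S" "b \<noteq> a" by blast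
      let ?V = "verbal_subgroup W (F\<lparr>carrier := M\<rparr>)"
      have V: "subgroup ?V F" by (rule F.verbal_subgroup_of_subgroup[OF M_sub])
      have "VN \<subseteq> ?V" "VA \<subseteq> ?V"
        unfolding VN_def VA_def
        using F.verbal_subgroup_mono[OF N.is_subgroup M_sub N_M] F.verbal_subgroup_mono[OF A_sub M_sub A_M] by auto
      then have "VN <#>\<^bsub>F\<^esub> VA \<subseteq> ?V <#>\<^bsub>F\<^esub> ?V" by (rule mono_set_mult)
      then have A_V: "A \<subseteq> ?V" using eq F.subgroup_mult_id[OF V] by simp
      interpret P: preserved_subset F S M A
      proof (intro preserved_subset.intro preserved_subset_axioms.intro F.free_on_axioms)
        fix h assume "h \<in> hom (F\<lparr>carrier := M\<rparr>) F"
        then interpret h: group_hom "F\<lparr>carrier := M\<rparr>" F h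
          by (intro group_hom.intro group_hom_axioms.intro F.subgroup_imp_group M_sub F.is_group)
        show "h ` A \<subseteq> A" using h.image_verbal_subgroup_subset[of W] A_V unfolding A_def by blast
      qed (rule M A_M)+
      obtain K n where K: "F.collapsing A K n" using P.exists_collapsing[OF a b] by blast
      \<comment> \<open>Properness enters only here: a word with a non-trivial value in some group
        has a non-empty free reduction.\<close>
      obtain w f where w: "w \<in> W" "range f \<subseteq> carrier H" "word_value H f w \<noteq> \<one>\<^bsub>H\<^esub>"
        using proper unfolding in_variety_def is_law_def by blast
      have "word_value H f (free_reduce w) = word_value H f w"
        using w(2) by (intro group.word_value_free_reduce[OF proper(1)]) auto
      then have "free_reduce w \<noteq> []" using w(3) by auto
      then obtain \<theta> where \<theta>: "range \<theta> \<subseteq> K" "word_value F \<theta> (free_reduce w) \<notin> A"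
        using F.collapsing_no_law[OF K reduced_free_reduce] by blast
      have \<theta>F: "range \<theta> \<subseteq> carrier F" using \<theta>(1) K by (auto simp: F.collapsing_def)
      then have "word_value F \<theta> (free_reduce w) = word_value F \<theta> w"
        by (intro F.word_value_free_reduce) auto
      moreover have "word_value F \<theta> w \<in> A"
        unfolding A_def using w(1) \<theta>F by (rule F.word_value_mem_verbal_subgroup)
      ultimately show False using \<theta>(2) by simp
    qed
  qed
  then show ?thesis using 1 2 unfolding M_def A_def VN_def by simp
qed

end
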